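(* For each $k\in\{3,4,5\}$, as $n\to\infty$, \[ \mathrm{ex}(n,K_3,\widehat{P}_k)= \left\lfloor\frac{k-1}{2}\right\rfloor\cdot \frac{n^2}{8}+o(n^2). \] Moreover, for $k=3$ and $k=5$ the error term $o(n^2)$ can be replaced by $O(n)$.
   Context: For graphs $T$ and $H$ (with no isolated vertices) and a positive integer $n$, the generalized Turán number $\mathrm{ex}(n,T,H)$ is the maximum number of copies of $T$ (subgraphs isomorphic to $T$, not necessarily induced) in an $n$-vertex graph that contains no subgraph isomorphic to $H$. $P_k$ denotes the path with $k$ edges. For a graph $H$, its suspension $\widehat{H}$ is the graph obtained from $H$ by adding one new vertex adjacent to all vertices of $H$. $K_3$ is the triangle. *)

theory Defs
  imports Complex_Main "HOL-Library.Landau_Symbols"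
begin

datatype 'a ugraph = UGraph (verts: "'a set") (edges: "'a set set")

definition simple_graph :: "'a ugraph \<Rightarrow> bool" where
  "simple_graph G \<longleftrightarrow> finite (verts G) \<and> (\<forall>e\<in>edges G. e \<subseteq> verts G \<and> card e = 2)"

definition subgraph :: "'a ugraph \<Rightarrow> 'a ugraph \<Rightarrow> bool" where
  "subgraph S G \<longleftrightarrow> simple_graph S \<and> simple_graph G \<and> verts S \<subseteq> verts G \<and> edges S \<subseteq> edges G"

definition isomorphic :: "'a ugraph \<Rightarrow> 'b ugraph \<Rightarrow> bool" where
  "isomorphic G H \<longleftrightarrow> (\<exists>f. bij_betw f (verts G) (verts H) \<and>
     (\<forall>u\<in>verts G. \<forall>v\<in>verts G. {u, v} \<in> edges G \<longleftrightarrow> {f u, f v} \<in> edges H))"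

text \<open>Copies are unlabelled and not necessarily induced: each subgraph is counted once,
  regardless of how many isomorphisms from \<open>T\<close> onto it there are.\<close>

definition copies :: "'b ugraph \<Rightarrow> 'a ugraph \<Rightarrow> 'a ugraph set" where
  "copies T G = {S. subgraph S G \<and> isomorphic T S}"

definition free_of :: "'b ugraph \<Rightarrow> 'a ugraph \<Rightarrow> bool" where
  "free_of H G \<longleftrightarrow> \<not> (\<exists>S. subgraph S G \<and> isomorphic H S)"

text \<open>Every finite graph has an isomorphic copy whose vertices are natural numbers, so it is
  enough to let the host graph range over those. The set of counts is always finite
  (lemma \<open>finite_copy_counts\<close> below); it is nonempty when \<open>H\<close> has an edge
  (lemma \<open>copy_counts_nonempty\<close>), so that the maximum is a genuine one.\<close>

definition copy_counts :: "nat \<Rightarrow> 'a ugraph \<Rightarrow> 'b ugraph \<Rightarrow> nat set" where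
  "copy_counts n T H = {card (copies T G) | G :: nat ugraph.
     simple_graph G \<and> card (verts G) = n \<and> free_of H G}"

definition gen_turan :: "nat \<Rightarrow> 'a ugraph \<Rightarrow> 'b ugraph \<Rightarrow> nat" where
  "gen_turan n T H = Max (copy_counts n T H)"

definition complete_graph :: "nat \<Rightarrow> nat ugraph" where
  "complete_graph r = UGraph {..<r} {{i, j} | i j. i < r \<and> j < r \<and> i \<noteq> j}"

text \<open>The path with \<open>k\<close> edges, hence \<open>k + 1\<close> vertices.\<close>

definition path_graph :: "nat \<Rightarrow> nat ugraph" where
  "path_graph k = UGraph {..k} {{i, Suc i} | i. i < k}"

text \<open>\<open>None\<close> is the new vertex.\<close>

definition suspension :: "'a ugraph \<Rightarrow> 'a option ugraph" where
  "suspension H = UGraph (insert None (Some ` verts H))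
     ((\<lambda>e. Some ` e) ` edges H \<union> {{None, Some v} | v. v \<in> verts H})"

lemma simple_graph_complete_graph: "simple_graph (complete_graph r)"
  by (auto simp: simple_graph_def complete_graph_def)

lemma simple_graph_path_graph: "simple_graph (path_graph k)"
  by (auto simp: simple_graph_def path_graph_def)

lemma simple_graph_suspension: "simple_graph H \<Longrightarrow> simple_graph (suspension H)"
  by (auto simp: simple_graph_def suspension_def card_image)

lemma finite_copy_counts: "finite (copy_counts n T H)"
proof -
  have "card (copies T G) \<le> 2 ^ n * 2 ^ (2 ^ n)"
    if "simple_graph G" "card (verts G) = n" for G :: "nat ugraph"
  proof -
    let ?A = "Pow (verts G) \<times> Pow (Pow (verts G))"
    have fin: "finite ?A"
      using that by (auto simp: simple_graph_def)
    have "copies T G \<subseteq> (\<lambda>(V, E). UGraph V E) ` ?A"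
    proof
      fix S assume "S \<in> copies T G"
      then have "(verts S, edges S) \<in> ?A"
        by (fastforce simp: copies_def subgraph_def simple_graph_def)
      moreover have "S = (\<lambda>(V, E). UGraph V E) (verts S, edges S)"
        by simp
      ultimately show "S \<in> (\<lambda>(V, E). UGraph V E) ` ?A"
        by (rule rev_image_eqI)
    qed
    then have "card (copies T G) \<le> card ?A"
      using fin by (rule surj_card_le[rotated])
    also have "\<dots> = 2 ^ n * 2 ^ (2 ^ n)"
      using that by (simp add: card_cartesian_product card_Pow simple_graph_def)
    finally show ?thesis .
  qed
  then have "copy_counts n T H \<subseteq> {..2 ^ n * 2 ^ (2 ^ n)}"
    by (auto simp: copy_counts_def)
  then show ?thesis
    using finite_subset by blast
qed

lemma copy_counts_nonempty:
  assumes "simple_graph H" "edges H \<noteq> {}"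
  shows "copy_counts n T H \<noteq> {}"
proof -
  obtain e where e: "e \<in> edges H" "e \<subseteq> verts H" "card e = 2"
    using assms by (auto simp: simple_graph_def)
  then obtain u v where "e = {u, v}"
    by (auto simp: card_2_iff)
  with e have "free_of H (UGraph {..<n} {})"
    by (fastforce simp: free_of_def subgraph_def isomorphic_def)
  moreover have "simple_graph (UGraph {..<n} {})"
    by (simp add: simple_graph_def)
  moreover have "card (verts (UGraph {..<n} {})) = n"
    by simp
  ultimately show ?thesis
    unfolding copy_counts_def by blast
qed

end

theory Submission
  imports Defs
begin

text \<open>
  A graph is free of the suspension of $P_k$ iff no link $L(x)$, the graph induced on the neighbours
  of $x$, contains a path with $k$ edges. Fix a threshold $C$ and call an edge heavy if it lies in more
  than $C$ triangles; the number of heavy edges is $O(n^2/C)$. If the three edges of a triangle $xyz$ are light,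
  then $d(x)+d(y)+d(z) \<le> n + 3C$. If only $yz$ is heavy, then $d(x)+d(y)$ and $d(x)+d(z)$ are at
  most $n$ plus a codegree. The other triangles are few, as are those with heavy $yz$ for which $xy$ or
  $xz$ lies in too many triangles. Adding these inequalities over all triangles bounds
  $\sum_x d(x) c(x)$, where $c(x)$ is a weighted number of edges of $L(x)$; bounds of Erdos--Gallai type
  on the number of edges of $L(x)$ give $c(x)\,d(x) \<ge> R(x)^2$ up to a constant factor, where $R(x)$ is
  the share of the triangles attributed to $x$. Completing the square, $n R - R^2 \<le> n^2/4$, then bounds
  the number of triangles.

  For $k = 4$ the link of a vertex of a $K_5$ has more edges than vertices. The degrees of the common
  neighbours of $x$, $y$, $z$ are therefore added, with weight $1/2$, to the inequality of a light triangle.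
  For $k = 5$ the threshold is $n/25$, so that there are only $O(n)$ heavy edges; this
  is small enough for light triangles because their inequality is not tight there. For $k = 3$ a constant
  threshold leaves no exceptional triangles at all.
\<close>

section \<open>Graphs without short paths\<close>

text \<open>The graph to match has half of its vertices split into cliques on q + 1 vertices, q the
  floor of (k-1)/2, all joined to an independent half. Its clique edges are heavy, and nearly every
  triangle is a clique edge with an apex x in the independent half; its other two edges lie in only
  q triangles. So the inequality for d(x)+d(y) is almost an equality, and the quantity
  \<open>r\<close> of the two quadratic bounds is about n/4 (k = 3, 4) or n/2 (k = 5) at every
  vertex, which is where the completed square vanishes. For k = 4 light triangles have an equality
  case of their own, links made of K_4, so a threshold linear in n would lose too much there; as
  exceptional triangles exist too, errors of order C n and n^2/C face each other and the argument
  yields only o(n^2). For k = 3 the second error is absent, for k = 5 the slack of light triangles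
  admits a linear threshold. Codegrees below such a threshold can still be linear in n; in d(x)+d(y)
  they are harmless because they are summed over a whole link instead of being bounded one by
  one.\<close>

text \<open>Everything is counted with order: \<open>arcs\<close> is twice the number of edges and \<open>otriangles\<close> six times
  the number of triangles of the graph induced on the given set.\<close>

definition nb :: "('a \<Rightarrow> 'a \<Rightarrow> bool) \<Rightarrow> 'a set \<Rightarrow> 'a \<Rightarrow> 'a set" where
  "nb R S v = {u \<in> S. R v u}"

definition arcs :: "('a \<Rightarrow> 'a \<Rightarrow> bool) \<Rightarrow> 'a set \<Rightarrow> nat" where
  "arcs R S = (\<Sum>v\<in>S. card (nb R S v))"

definition otriangles :: "('a \<Rightarrow> 'a \<Rightarrow> bool) \<Rightarrow> 'a set \<Rightarrow> nat" where
  "otriangles R S = (\<Sum>x\<in>S. \<Sum>y\<in>nb R S x. card (nb R S x \<inter> nb R S y))"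

definition path_in :: "('a \<Rightarrow> 'a \<Rightarrow> bool) \<Rightarrow> 'a set \<Rightarrow> 'a list \<Rightarrow> bool" where
  "path_in R S xs \<longleftrightarrow> distinct xs \<and> set xs \<subseteq> S \<and> successively R xs"

text \<open>\<open>r\<close> counts vertices: links in a graph without the suspension of P_k satisfy
  this with \<open>r = k + 1\<close>, so 4, 5, 6 below stand for k = 3, 4, 5.\<close>

definition path_free :: "('a \<Rightarrow> 'a \<Rightarrow> bool) \<Rightarrow> 'a set \<Rightarrow> nat \<Rightarrow> bool" where
  "path_free R S r \<longleftrightarrow> (\<forall>xs. path_in R S xs \<longrightarrow> length xs < r)"

lemma path_free_mono:
  assumes "path_free R S r" "S' \<subseteq> S" "\<And>x y. R' x y \<Longrightarrow> R x y"
  shows "path_free R' S' r"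
proof -
  have "path_in R S xs" if "path_in R' S' xs" for xs
    using that assms(2,3) successively_mono[of R' xs R] unfolding path_in_def by auto
  then show ?thesis
    using assms(1) unfolding path_free_def by blast
qed

lemma finite_nb [simp]: "finite S \<Longrightarrow> finite (nb R S v)"
  by (simp add: nb_def)

lemma card_nb_le: "finite S \<Longrightarrow> card (nb R S v) \<le> card S"
  unfolding nb_def by (rule card_mono) auto

text \<open>The cycle closing argument of Ore: the end vertices of a longest path have at least as many
  neighbours on it, counted together, as it has vertices. So its vertices carry a cycle, and no edge
  leaves a cycle spanning a longest path.\<close>

lemma closed_set_of_min_degree:
  assumes fin: "finite S" and ne: "S \<noteq> {}"
    and sym: "\<And>x y. R x y \<Longrightarrow> R y x" and irr: "\<And>x. \<not> R x x"
    and deg: "\<And>v. v \<in> S \<Longrightarrow> \<delta> \<le> card (nb R S v)"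
    and free: "path_free R S r" and r: "r \<le> 2 * \<delta> + 1"
  shows "\<exists>U. U \<subseteq> S \<and> U \<noteq> {} \<and> card U < r \<and> (\<forall>u\<in>U. \<forall>w\<in>S. R u w \<longrightarrow> w \<in> U)"
proof -
  have bnd: "length xs < r" if "path_in R S xs" for xs
    using free that unfolding path_free_def by blast
  obtain v0 where v0: "v0 \<in> S" using ne by auto
  have p0: "path_in R S [v0]" using v0 by (simp add: path_in_def)
  obtain xs where xs: "path_in R S xs" and mx: "\<And>ys. path_in R S ys \<Longrightarrow> length ys \<le> length xs"
    using ex_has_greatest_nat[of "path_in R S" "[v0]" length r] p0 bnd by (metis less_imp_le)
  define m where "m = length xs"
  have m0: "m > 0" using mx[OF p0] by (cases xs) (auto simp: m_def)
  have mr: "m < r" using bnd[OF xs] by (simp add: m_def)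
  have dist: "distinct xs" and sub: "set xs \<subseteq> S" and suc: "successively R xs"
    using xs by (auto simp: path_in_def)
  have step: "R (xs ! i) (xs ! Suc i)" if "Suc i < m" for i
    using suc that by (simp add: successively_conv_nth m_def)
  have end_out: "w \<in> set ys" if ys: "path_in R S ys" "length ys = m" and "w \<in> S" "R (last ys) w" for ys w
  proof (rule ccontr)
    assume "w \<notin> set ys"
    then have "path_in R S (ys @ [w])"
      using that m0 by (auto simp: path_in_def successively_append_iff)
    from mx[OF this] ys show False by (simp add: m_def)
  qed
  have revp: "path_in R S (rev xs)"
  proof -
    have "successively (\<lambda>x y. R y x) xs" using suc sym by (auto intro: successively_mono)
    then show ?thesis using dist sub by (simp add: path_in_def successively_rev)
  qed
  have nbs: "nb R S (xs ! (m - 1)) \<subseteq> set xs" "nb R S (xs ! 0) \<subseteq> set xs"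
    using end_out[OF xs] end_out[OF revp] m0
    by (auto simp: nb_def m_def last_conv_nth last_rev hd_conv_nth)
  define I where "I = {i. Suc i < m \<and> R (xs ! 0) (xs ! Suc i)}"
  define J where "J = {i. Suc i < m \<and> R (xs ! i) (xs ! (m - 1))}"
  have IJ: "I \<union> J \<subseteq> {..<m - 1}" by (auto simp: I_def J_def)
  then have "finite I" "finite J" using finite_subset[of _ "{..<m - 1}"] by auto
  note finIJ = this IJ
  have "nb R S (xs ! 0) \<subseteq> (\<lambda>i. xs ! Suc i) ` I"
  proof
    fix w assume w: "w \<in> nb R S (xs ! 0)"
    then obtain j where j: "j < m" "w = xs ! j"
      using nbs(2) by (metis in_set_conv_nth m_def subsetD)
    have "j \<noteq> 0" using w j irr by (metis mem_Collect_eq nb_def)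
    then obtain i where "j = Suc i" using not0_implies_Suc by blast
    then show "w \<in> (\<lambda>i. xs ! Suc i) ` I" using j w by (auto simp: I_def nb_def)
  qed
  then have cI: "\<delta> \<le> card I"
    using deg[of "xs ! 0"] sub m0 finIJ surj_card_le
    by (metis le_trans m_def nth_mem subsetD)
  have "nb R S (xs ! (m - 1)) \<subseteq> (\<lambda>i. xs ! i) ` J"
  proof
    fix w assume w: "w \<in> nb R S (xs ! (m - 1))"
    then obtain j where j: "j < m" "w = xs ! j"
      using nbs(1) by (metis in_set_conv_nth m_def subsetD)
    have "j \<noteq> m - 1" using w j irr by (metis mem_Collect_eq nb_def)
    then have "j \<in> J" using j w sym by (auto simp: J_def nb_def)
    then show "w \<in> (\<lambda>i. xs ! i) ` J" using j by auto
  qed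
  then have cJ: "\<delta> \<le> card J"
    using deg[of "xs ! (m - 1)"] sub m0 finIJ surj_card_le
    by (metis diff_less le_trans less_numeral_extra(1) m_def nth_mem subsetD)
  \<comment> \<open>Both sets have at least \<open>\<delta>\<close> elements in
    \<open>{..<m - 1}\<close>, while \<open>m < r \<le> 2 * \<delta> + 1\<close>.\<close>
  have "I \<inter> J \<noteq> {}"
  proof
    assume "I \<inter> J = {}"
    then have "card I + card J = card (I \<union> J)" using finIJ by (simp add: card_Un_disjoint)
    also have "\<dots> \<le> m - 1" using card_mono[OF _ finIJ(3)] by simp
    finally show False using cI cJ r mr m0 by linarith
  qed
  then obtain i where i: "Suc i < m" "R (xs ! 0) (xs ! Suc i)" "R (xs ! i) (xs ! (m - 1))"
    by (auto simp: I_def J_def)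
  \<comment> \<open>Along the path to position \<open>i\<close>, across to its last vertex and
    backwards to position \<open>Suc i\<close>; the edge from there to the first vertex closes the
    cycle.\<close>
  define cy where "cy = take (Suc i) xs @ rev (drop (Suc i) xs)"
  have ne1: "take (Suc i) xs \<noteq> []" "drop (Suc i) xs \<noteq> []" using i m_def by auto
  have eqs: "last (take (Suc i) xs) = xs ! i" "last xs = xs ! (m - 1)"
    "hd (drop (Suc i) xs) = xs ! Suc i" "hd xs = xs ! 0"
    using i m0 by (auto simp: m_def last_conv_nth hd_drop_conv_nth hd_conv_nth take_Suc_conv_app_nth)
  have s1: "successively R (take (Suc i) xs)" "successively R (drop (Suc i) xs)"
    using suc successively_append_iff[of R "take (Suc i) xs" "drop (Suc i) xs"] by auto
  have s2: "successively R (rev (drop (Suc i) xs))"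
    using s1(2) sym by (auto simp: successively_rev intro: successively_mono)
  have last_drop': "last (drop (Suc i) xs) = last xs"
    using i by (simp add: m_def)
  have cys: "successively R cy"
    unfolding cy_def successively_append_iff using s1 s2 ne1 i eqs last_drop'
    by (simp add: hd_rev)
  have cyset: "set cy = set xs"
    unfolding cy_def by (metis append_take_drop_id set_append set_rev)
  have cydist: "distinct cy"
    unfolding cy_def using dist
    by (metis append_take_drop_id distinct_append distinct_rev set_rev)
  have cyclose: "R (last cy) (hd cy)"
    using ne1 i eqs sym by (auto simp: cy_def last_rev)
  \<comment> \<open>Cutting the cycle right after \<open>u\<close> gives another longest path, one
    that ends in \<open>u\<close>, so the neighbours of \<open>u\<close> lie on it.\<close>
  have leave: "w \<in> set xs" if u: "u \<in> set xs" and w: "w \<in> S" "R u w" for u w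
  proof -
    obtain as bs where ab: "cy = as @ u # bs" using u cyset by (metis split_list)
    have "successively R (bs @ as @ [u])"
      using cys cyclose unfolding ab
      by (cases "as = []"; cases "bs = []")
        (auto simp: successively_append_iff successively_Cons hd_append split: if_splits)
    then have p: "path_in R S (bs @ as @ [u])"
      using cydist cyset sub unfolding ab path_in_def by auto
    have "length cy = m" using cydist cyset dist by (metis distinct_card m_def)
    then have "length (bs @ as @ [u]) = m" by (simp add: ab)
    from end_out[OF p this w(1)] w(2) have "w \<in> set (bs @ as @ [u])" by simp
    then show ?thesis using cyset ab by auto
  qed
  have "card (set xs) < r" using mr dist by (simp add: distinct_card m_def)
  moreover have "set xs \<noteq> {}" using m0 by (auto simp: m_def)
  ultimately show ?thesis using leave sub by blast
qed

section \<open>Edge counts of graphs without paths on five or six vertices\<close>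

lemma arcs_le_square:
  assumes "finite S" "\<And>x. \<not> R x x"
  shows "arcs R S \<le> card S * (card S - 1)"
proof -
  have "card (nb R S v) \<le> card S - 1" if "v \<in> S" for v
  proof -
    have "nb R S v \<subseteq> S - {v}" using assms by (auto simp: nb_def)
    then show ?thesis using assms that by (metis card_Diff_singleton card_mono finite_Diff)
  qed
  then show ?thesis
    unfolding arcs_def using sum_bounded_above[of S "\<lambda>v. card (nb R S v)" "card S - 1"] by simp
qed

lemma arcs_split_closed:
  assumes "finite S" "U \<subseteq> S" "\<And>x y. R x y \<Longrightarrow> R y x" "\<And>u w. u \<in> U \<Longrightarrow> w \<in> S \<Longrightarrow> R u w \<Longrightarrow> w \<in> U"
  shows "arcs R S = arcs R (S - U) + arcs R U"
proof -
  have "nb R S v = nb R U v" if "v \<in> U" for v using assms that by (auto simp: nb_def)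
  moreover have "nb R S v = nb R (S - U) v" if "v \<in> S - U" for v
    using assms that by (auto simp: nb_def)
  ultimately show ?thesis
    unfolding arcs_def using sum.subset_diff[OF assms(2,1), of "\<lambda>v. card (nb R S v)"] by simp
qed

lemma card_nb_of_bool: "finite S \<Longrightarrow> card (nb R S v) = (\<Sum>u\<in>S. of_bool (R v u))"
  by (simp add: nb_def Int_def)

lemma arcs_remove:
  assumes "finite S" "v \<in> S" "\<And>x y. R x y \<Longrightarrow> R y x" and irr: "\<And>x. \<not> R x x"
  shows "arcs R S = arcs R (S - {v}) + 2 * card (nb R S v)"
proof -
  have "card (nb R S u) = card (nb R (S - {v}) u) + of_bool (R v u)" if "u \<in> S - {v}" for u
  proof -
    have "card (nb R S u) = of_bool (R u v) + card (nb R (S - {v}) u)"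
      using assms(1,2) by (simp only: card_nb_of_bool finite_Diff sum.remove[of S v])
    then show ?thesis using assms(3)[of u v] assms(3)[of v u] by auto
  qed
  then have "(\<Sum>u\<in>S - {v}. card (nb R S u)) = arcs R (S - {v}) + (\<Sum>u\<in>S - {v}. of_bool (R v u))"
    by (simp add: arcs_def sum.distrib)
  moreover have "(\<Sum>u\<in>S - {v}. of_bool (R v u)) = card (nb R S v)"
    using assms(1,2) irr by (simp only: card_nb_of_bool sum.remove[of S v]) simp
  ultimately show ?thesis
    unfolding arcs_def using assms by (simp add: sum.remove[of S v])
qed

text \<open>Doubling the degree sum over \<open>U\<close> counts the edges leaving \<open>U\<close>
  correctly, but the edges inside four times instead of twice; \<open>arcs R U\<close> on the left
  makes up for this.\<close>

lemma arcs_remove_set: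
  assumes "finite S" "U \<subseteq> S" "\<And>x y. R x y \<Longrightarrow> R y x"
  shows "arcs R S + arcs R U = arcs R (S - U) + 2 * (\<Sum>u\<in>U. card (nb R S u))"
proof -
  have fU: "finite U" using assms finite_subset by blast
  have split: "card (nb R S v) = card (nb R (S - U) v) + card (nb R U v)" for v
  proof -
    have "nb R S v = nb R (S - U) v \<union> nb R U v" "nb R (S - U) v \<inter> nb R U v = {}"
      using assms by (auto simp: nb_def)
    then show ?thesis using assms fU by (simp add: card_Un_disjoint)
  qed
  have swap: "(\<Sum>v\<in>S - U. card (nb R U v)) = (\<Sum>v\<in>U. card (nb R (S - U) v))"
  proof -
    have "(\<Sum>v\<in>S - U. card (nb R U v)) = (\<Sum>v\<in>S - U. \<Sum>u\<in>U. of_bool (R v u))"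
      using fU by (simp only: card_nb_of_bool)
    also have "\<dots> = (\<Sum>u\<in>U. \<Sum>v\<in>S - U. of_bool (R v u))" by (rule sum.swap)
    also have "\<dots> = (\<Sum>u\<in>U. \<Sum>v\<in>S - U. of_bool (R u v))"
      using assms(3) by (intro sum.cong refl) (metis of_bool_eq_iff)
    finally show ?thesis using assms by (simp only: card_nb_of_bool finite_Diff)
  qed
  have "arcs R S = (\<Sum>v\<in>S - U. card (nb R S v)) + (\<Sum>v\<in>U. card (nb R S v))"
    unfolding arcs_def using sum.subset_diff[OF assms(2,1)] by blast
  also have "(\<Sum>v\<in>S - U. card (nb R S v)) = arcs R (S - U) + (\<Sum>v\<in>U. card (nb R (S - U) v))"
    by (simp add: split sum.distrib swap arcs_def)
  finally show ?thesis by (simp add: split sum.distrib arcs_def)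
qed

lemma otriangles_superadditive:
  assumes "finite S" "A \<union> B \<subseteq> S" "A \<inter> B = {}"
  shows "otriangles R A + otriangles R B \<le> otriangles R S"
proof -
  have fin: "finite A" "finite B" using assms finite_subset by auto
  have *: "(\<Sum>y\<in>nb R C x. card (nb R C x \<inter> nb R C y)) \<le> (\<Sum>y\<in>nb R S x. card (nb R S x \<inter> nb R S y))"
    if "C \<subseteq> S" for C x
  proof -
    have "(\<Sum>y\<in>nb R C x. card (nb R C x \<inter> nb R C y)) \<le> (\<Sum>y\<in>nb R C x. card (nb R S x \<inter> nb R S y))"
      using assms that by (intro sum_mono card_mono) (auto simp: nb_def)
    also have "\<dots> \<le> (\<Sum>y\<in>nb R S x. card (nb R S x \<inter> nb R S y))"
      using assms that by (intro sum_mono2) (auto simp: nb_def)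
    finally show ?thesis .
  qed
  have "otriangles R A + otriangles R B
      \<le> (\<Sum>x\<in>A. \<Sum>y\<in>nb R S x. card (nb R S x \<inter> nb R S y)) + (\<Sum>x\<in>B. \<Sum>y\<in>nb R S x. card (nb R S x \<inter> nb R S y))"
    unfolding otriangles_def using assms by (intro add_mono sum_mono *) auto
  also have "\<dots> = (\<Sum>x\<in>A \<union> B. \<Sum>y\<in>nb R S x. card (nb R S x \<inter> nb R S y))"
    using assms fin by (simp add: sum.union_disjoint)
  also have "\<dots> \<le> otriangles R S"
    unfolding otriangles_def using assms by (intro sum_mono2) auto
  finally show ?thesis .
qed

text \<open>The Erdos-Gallai bound, tight for disjoint copies of K_5. A vertex of degree at most two
  is removed; otherwise minimum degree three yields a closed set of at most five vertices, each with
  at most four neighbours.\<close>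

lemma arcs_le_if_path_free_6:
  assumes "finite S" and sym: "\<And>x y. R x y \<Longrightarrow> R y x" and irr: "\<And>x. \<not> R x x"
    and "path_free R S 6"
  shows "arcs R S \<le> 4 * card S"
  using assms(1,4)
proof (induction S rule: finite_psubset_induct)
  case (psubset S)
  have IH: "arcs R (S - U) \<le> 4 * card (S - U)" if "U \<subseteq> S" "U \<noteq> {}" for U
    using psubset.IH[of "S - U"] that path_free_mono[OF psubset.prems, of "S - U" R] by blast
  consider "S = {}" | v where "v \<in> S" "card (nb R S v) \<le> 2"
    | "S \<noteq> {}" "\<And>v. v \<in> S \<Longrightarrow> 3 \<le> card (nb R S v)"
    by (metis not_less_eq_eq numeral_3_eq_3 numeral_2_eq_2 ex_in_conv)
  then show ?case
  proof cases
    case 1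
    then show ?thesis by (simp add: arcs_def)
  next
    case (2 v)
    have "arcs R S \<le> arcs R (S - {v}) + 4"
      using arcs_remove[of S v R] 2 psubset.hyps sym irr by simp
    moreover have "card S = card (S - {v}) + 1"
      using 2 psubset.hyps by (metis Suc_eq_plus1 card_Suc_Diff1)
    ultimately show ?thesis using IH[of "{v}"] 2 by simp
  next
    case 3
    obtain U where U: "U \<subseteq> S" "U \<noteq> {}" "card U < 6" "\<forall>u\<in>U. \<forall>w\<in>S. R u w \<longrightarrow> w \<in> U"
      using closed_set_of_min_degree[of S R 3 6] 3 psubset sym irr by auto
    have fU: "finite U" using U psubset.hyps finite_subset by blast
    have "arcs R U \<le> card U * (card U - 1)" using arcs_le_square[OF fU] irr by blast
    also have "\<dots> \<le> card U * 4" using U by (intro mult_le_mono2) simp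
    finally have "arcs R U \<le> 4 * card U" by simp
    moreover have "arcs R S = arcs R (S - U) + arcs R U"
      using arcs_split_closed[of S U R] psubset.hyps U sym by auto
    moreover have "card S = card (S - U) + card U"
      using U psubset.hyps fU by (metis card_Diff_subset card_mono le_add_diff_inverse2)
    ultimately show ?thesis using IH[OF U(1,2)] by simp
  qed
qed

text \<open>A finite check over the six possible edges. The constant \<open>48\<close> is 12 per
  vertex; K_4 (72 = 48 + 24) and K_4 minus an edge (60 = 48 + 12) both give equality.\<close>

lemma arcs_le_four_vertices:
  assumes "distinct [a, b, c, d]" "\<And>x y. R x y \<Longrightarrow> R y x" "\<And>x. \<not> R x x"
  shows "6 * arcs R {a, b, c, d} \<le> 48 + otriangles R {a, b, c, d}"
proof -
  let ?S = "{a, b, c, d}"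
  have fin: "finite ?S" by simp
  have nbi: "card (nb R ?S x \<inter> nb R ?S y) = (\<Sum>u\<in>?S. of_bool (R x u \<and> R y u))" for x y
  proof -
    have "nb R ?S x \<inter> nb R ?S y = nb (\<lambda>_ u. R x u \<and> R y u) ?S x"
      unfolding nb_def by blast
    then show ?thesis by (simp only: card_nb_of_bool[OF fin])
  qed
  have inner: "(\<Sum>y\<in>nb R ?S x. f y) = (\<Sum>y\<in>?S. of_bool (R x y) * f y)" for f :: "'a \<Rightarrow> nat" and x
    unfolding nb_def sum.inter_filter[OF fin] by (rule sum.cong) auto
  have sy: "R b a = R a b" "R c a = R a c" "R d a = R a d" "R c b = R b c" "R d b = R b d" "R d c = R c d"
    using assms(2) by blast+
  have ir: "\<not> R a a" "\<not> R b b" "\<not> R c c" "\<not> R d d" using assms(3) by auto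
  show ?thesis
    unfolding arcs_def otriangles_def inner nbi card_nb_of_bool[OF fin]
    using assms(1)
    by (simp add: sy ir del: sum_of_bool_eq sum_of_bool_mult_eq sum_mult_of_bool_eq)
qed

text \<open>Only components isomorphic to $K_4$ or to $K_4$ minus an edge have more edges than vertices.\<close>

lemma arcs_le_if_path_free_5:
  assumes "finite S" and sym: "\<And>x y. R x y \<Longrightarrow> R y x" and irr: "\<And>x. \<not> R x x"
    and "path_free R S 5"
  shows "6 * arcs R S \<le> 12 * card S + otriangles R S"
  using assms(1,4)
proof (induction S rule: finite_psubset_induct)
  case (psubset S)
  have IH: "6 * arcs R (S - U) \<le> 12 * card (S - U) + otriangles R (S - U)" if "U \<subseteq> S" "U \<noteq> {}" for U
    using psubset.IH[of "S - U"] that path_free_mono[OF psubset.prems, of "S - U" R] by blast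
  have sup: "otriangles R (S - U) + otriangles R U \<le> otriangles R S" if "U \<subseteq> S" for U
    using otriangles_superadditive[of S "S - U" U R] that psubset.hyps by auto
  consider "S = {}" | v where "v \<in> S" "card (nb R S v) \<le> 1"
    | "S \<noteq> {}" "\<And>v. v \<in> S \<Longrightarrow> 2 \<le> card (nb R S v)"
    by (metis not_less_eq_eq numeral_2_eq_2 ex_in_conv One_nat_def)
  then show ?case
  proof cases
    case 1
    then show ?thesis by (simp add: arcs_def)
  next
    case (2 v)
    have "arcs R S \<le> arcs R (S - {v}) + 2"
      using arcs_remove[of S v R] 2 psubset.hyps sym irr by simp
    moreover have "card S = card (S - {v}) + 1"
      using 2 psubset.hyps by (metis Suc_eq_plus1 card_Suc_Diff1)
    ultimately show ?thesis using IH[of "{v}"] sup[of "{v}"] 2 by simp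
  next
    case 3
    obtain U where U: "U \<subseteq> S" "U \<noteq> {}" "card U < 5" "\<forall>u\<in>U. \<forall>w\<in>S. R u w \<longrightarrow> w \<in> U"
      using closed_set_of_min_degree[of S R 2 5] 3 psubset sym irr by auto
    have fU: "finite U" using U psubset.hyps finite_subset by blast
    have sq: "arcs R U \<le> card U * (card U - 1)" using arcs_le_square[OF fU] irr by blast
    have "6 * arcs R U \<le> 12 * card U + otriangles R U"
    proof (cases "card U = 4")
      case True
      then obtain xs where "set xs = U" "distinct xs" "length xs = 4"
        using fU by (metis finite_distinct_list distinct_card)
      then obtain a b c d where "U = {a, b, c, d}" "distinct [a, b, c, d]"
        by (auto simp: numeral_eq_Suc length_Suc_conv)
      then show ?thesis using arcs_le_four_vertices[of a b c d R] sym irr True by simp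
    next
      \<comment> \<open>At most three vertices remain, so each has at most two neighbours in
        \<open>U\<close> and the term for triangles is not called upon.\<close>
      case False
      then have "card U - 1 \<le> 2" using U by simp
      then have "card U * (card U - 1) \<le> card U * 2" by (rule mult_le_mono2)
      then show ?thesis using sq by linarith
    qed
    moreover have "arcs R S = arcs R (S - U) + arcs R U"
      using arcs_split_closed[of S U R] psubset.hyps U sym by auto
    moreover have "card S = card (S - U) + card U"
      using U psubset.hyps fU by (metis card_Diff_subset card_mono le_add_diff_inverse2)
    ultimately show ?thesis using IH[OF U(1,2)] sup[OF U(1)] by simp
  qed
qed

text \<open>Three common neighbours u, v, w would give the path u y v z w.\<close>

lemma card_common_nb_le_2:
  assumes "finite S" and sym: "\<And>x y. R x y \<Longrightarrow> R y x" and irr: "\<And>x. \<not> R x x"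
    and "path_free R S 5" and "y \<in> S" "z \<in> S" "R y z"
  shows "card (nb R S y \<inter> nb R S z) \<le> 2"
proof (rule ccontr)
  assume "\<not> ?thesis"
  then have "3 \<le> card (nb R S y \<inter> nb R S z)" by simp
  then obtain W where W: "W \<subseteq> nb R S y \<inter> nb R S z" "card W = 3"
    by (meson obtain_subset_with_card_n)
  then obtain u v w where uvw: "W = {u, v, w}" "u \<noteq> v" "v \<noteq> w" "u \<noteq> w" by (auto simp: card_3_iff)
  have "path_in R S [u, y, v, z, w]"
    using W uvw assms by (auto simp: path_in_def nb_def)
  then show False using assms(4) by (auto simp: path_free_def)
qed

lemma otriangles_le_if_path_free_5:
  assumes "finite S" and sym: "\<And>x y. R x y \<Longrightarrow> R y x" and irr: "\<And>x. \<not> R x x"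
    and "path_free R S 5"
  shows "otriangles R S \<le> 2 * arcs R S"
proof -
  have "(\<Sum>y\<in>nb R S x. card (nb R S x \<inter> nb R S y)) \<le> 2 * card (nb R S x)" if "x \<in> S" for x
  proof -
    have "(\<Sum>y\<in>nb R S x. card (nb R S x \<inter> nb R S y)) \<le> (\<Sum>y\<in>nb R S x. 2)"
      using that assms by (intro sum_mono card_common_nb_le_2) (auto simp: nb_def)
    then show ?thesis by simp
  qed
  then show ?thesis
    unfolding otriangles_def arcs_def sum_distrib_left by (rule sum_mono)
qed

section \<open>Marked edges in graphs without paths on six vertices\<close>

lemma no_path_6:
  assumes "path_free R S 6" "distinct [a, b, c, d, e, f]" "{a, b, c, d, e, f} \<subseteq> S"
    "R a b" "R b c" "R c d" "R d e" "R e f"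
  shows False
proof -
  have "path_in R S [a, b, c, d, e, f]" using assms(2-) by (simp add: path_in_def)
  then show False using assms(1) by (auto simp: path_free_def)
qed

lemma exists_other_nb:
  assumes "2 \<le> card (nb R S v)"
  obtains u where "u \<in> S" "R v u" "u \<noteq> a"
proof -
  have "\<not> nb R S v \<subseteq> {a}" using assms card_mono[of "{a}" "nb R S v"] by auto
  then show ?thesis using that by (auto simp: nb_def)
qed

text \<open>The component of \<open>y\<close> is complete bipartite with parts \<open>{y, t}\<close>
  and \<open>nb R S y\<close>. Every neighbour of \<open>y\<close> has a further neighbour by the
  degree condition, and all of these coincide, as otherwise a path on six vertices runs through
  \<open>y\<close>.\<close>

lemma independent_nb_component:
  assumes fin: "finite S" and sym: "\<And>x y. R x y \<Longrightarrow> R y x" and irr: "\<And>x. \<not> R x x"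
    and free: "path_free R S 6" and deg: "\<And>v. v \<in> S \<Longrightarrow> 2 \<le> card (nb R S v)"
    and y: "y \<in> S" "3 \<le> card (nb R S y)"
    and indep: "\<And>u w. u \<in> nb R S y \<Longrightarrow> w \<in> nb R S y \<Longrightarrow> \<not> R u w"
  shows "\<exists>t\<in>S. t \<noteq> y \<and> t \<notin> nb R S y \<and> nb R S t = nb R S y \<and> (\<forall>u\<in>nb R S y. nb R S u = {y, t})"
proof -
  have symi: "R a b = R b a" for a b using sym by blast
  define N where "N = nb R S y"
  have NS: "N \<subseteq> S" "y \<notin> N" and Ny: "\<And>u. u \<in> N \<longleftrightarrow> u \<in> S \<and> R y u"
    using irr by (auto simp: N_def nb_def)
  note n6 = no_path_6[OF free]
  have unique: "t1 = t2" if u: "u1 \<in> N" "u2 \<in> N" "u1 \<noteq> u2"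
    and t: "t1 \<in> S" "t2 \<in> S" "R u1 t1" "R u2 t2" "t1 \<noteq> y" "t2 \<noteq> y" for u1 u2 t1 t2
  proof (rule ccontr)
    assume ne: "t1 \<noteq> t2"
    have "\<not> N \<subseteq> {u1, u2}"
      using y(2) card_mono[of "{u1, u2}" N] u by (auto simp: N_def)
    then obtain u3 where u3: "u3 \<in> N" "u3 \<noteq> u1" "u3 \<noteq> u2" by auto
    obtain t3 where t3: "t3 \<in> S" "R u3 t3" "t3 \<noteq> y"
      using exists_other_nb[OF deg[of u3]] u3 NS by blast
    have tN: "t1 \<notin> N" "t2 \<notin> N" "t3 \<notin> N" using indep u u3 t t3 by (auto simp: N_def)
    have "u1 \<in> S" "u2 \<in> S" "u3 \<in> S" using u u3 NS by auto
    note S = this t(1,2) t3(1) y(1)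
    have adj: "R y u1" "R y u2" "R y u3" "R u1 y" "R u2 y" "R u3 y" "R t1 u1" "R t2 u2" "R t3 u3"
      using u u3 t t3 Ny sym by blast+
    note facts = S adj t t3 u u3 tN NS(2) ne
    have "t3 \<noteq> t1" using n6[of u3 t1 u1 y u2 t2] facts by auto
    have "t3 \<noteq> t2" using n6[of u3 t2 u2 y u1 t1] facts by auto
    obtain q where q: "q \<in> S" "R t1 q" "q \<noteq> u1"
      using exists_other_nb[OF deg[OF t(1)]] by blast
    have "q \<noteq> y" using q(2) tN(1) t(1) sym[of t1 q] Ny[of t1] by auto
    have "q \<noteq> t1" using q irr by blast
    consider "q = u2" | "q = t2" | "q \<noteq> u2" "q \<noteq> t2" by blast
    then show False
    proof cases
      case 1
      then show False
        using n6[of u1 t1 u2 y u3 t3] facts q \<open>t3 \<noteq> t1\<close> by auto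
    next
      case 2
      then show False
        using n6[of t2 t1 u1 y u3 t3] facts q \<open>t3 \<noteq> t1\<close> \<open>t3 \<noteq> t2\<close> sym[of t1 q] by auto
    next
      case 3
      then show False
        using n6[of q t1 u1 y u2 t2] facts q \<open>q \<noteq> y\<close> \<open>q \<noteq> t1\<close> sym[of t1 q] by auto
    qed
  qed
  have "N \<noteq> {}" using y(2) by (auto simp: N_def)
  then obtain u1 where u1: "u1 \<in> N" by auto
  obtain t where t: "t \<in> S" "R u1 t" "t \<noteq> y"
    using exists_other_nb[OF deg[of u1]] u1 NS by blast
  have "\<not> N \<subseteq> {u1}" using y(2) card_mono[of "{u1}" N] by (auto simp: N_def)
  then obtain u2 where u2: "u2 \<in> N" "u2 \<noteq> u1" by auto
  have tN: "t \<notin> N" using indep u1 t by (auto simp: N_def)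
  have nbN: "nb R S u = {y, t}" if "u \<in> N" for u
  proof -
    have only: "s = t" if s: "s \<in> S" "R u s" "s \<noteq> y" for s
    proof (cases "u = u1")
      case False
      then show ?thesis using unique[of u u1 s t] \<open>u \<in> N\<close> u1 s t by auto
    next
      case True
      obtain t2 where t2: "t2 \<in> S" "R u2 t2" "t2 \<noteq> y"
        using exists_other_nb[OF deg[of u2]] u2 NS by blast
      then show ?thesis using unique[of u1 u2 s t2] unique[of u1 u2 t t2] u1 u2 s t True by auto
    qed
    have "u \<in> S" using that NS by auto
    then obtain s where "s \<in> S" "R u s" "s \<noteq> y" using exists_other_nb[OF deg] by blast
    then have "t \<in> nb R S u" using only by (auto simp: nb_def)
    moreover have "y \<in> nb R S u" using that Ny y by (auto simp: nb_def symi)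
    ultimately show ?thesis using only by (auto simp: nb_def)
  qed
  have nbt: "nb R S t = N"
  proof
    show "N \<subseteq> nb R S t" using nbN NS symi[of t] by (auto simp: nb_def)
    \<comment> \<open>A neighbour \<open>a\<close> of \<open>t\<close> outside \<open>N\<close> has
      a further neighbour \<open>a'\<close>, and a' a t u1 y u2 is a path.\<close>
    show "nb R S t \<subseteq> N"
    proof (rule ccontr)
      assume "\<not> ?thesis"
      then obtain a where a: "a \<in> S" "R t a" "a \<notin> N" by (auto simp: nb_def)
      obtain a' where a': "a' \<in> S" "R a a'" "a' \<noteq> t" using exists_other_nb[OF deg[OF a(1)]] by blast
      have "a \<noteq> y" using a(2) tN t(1) sym[of t a] Ny[of t] by auto
      have "a \<noteq> t" using a irr by blast
      have "a' \<noteq> y" using a(1,3) a'(2) sym[of a a'] Ny[of a] by auto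
      have "a' \<noteq> a" using a' irr by blast
      have "a' \<notin> N"
      proof
        assume "a' \<in> N"
        then have "a \<in> {y, t}" using nbN[of a'] a(1) sym[OF a'(2)] by (auto simp: nb_def)
        then show False using \<open>a \<noteq> y\<close> \<open>a \<noteq> t\<close> by auto
      qed
      have "R t u1" "R u1 y" "R y u2" "u1 \<in> S" "u2 \<in> S" using u1 u2 t symi[of y u1] symi[of t u1] Ny by auto
      then show False
        using n6[of a' a t u1 y u2] a a' u1 u2 t y NS tN sym[of t a] sym[of a a'] \<open>a \<noteq> y\<close> \<open>a \<noteq> t\<close> \<open>a' \<noteq> y\<close>
          \<open>a' \<noteq> a\<close> \<open>a' \<notin> N\<close> by auto
    qed
  qed
  show ?thesis using t tN nbN nbt by (auto simp: N_def)
qed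

text \<open>Vertices of degree at most two pay for all edges at them, marked edges within being counted twice.
  Any other vertex on a marked edge lies, once vertices of degree at most one are removed, in a
  complete bipartite component with two vertices on one side.\<close>

lemma arcs_marked_le:
  assumes "finite S" and sym: "\<And>x y. R x y \<Longrightarrow> R y x" and irr: "\<And>x. \<not> R x x"
    and symM: "\<And>x y. M x y \<Longrightarrow> M y x" and MR: "\<And>x y. M x y \<Longrightarrow> R x y"
    and "path_free R S 6"
    and "\<And>y z. y \<in> S \<Longrightarrow> z \<in> S \<Longrightarrow> M y z \<Longrightarrow> card (nb R S y) \<le> 2 \<or>
      (card (nb M S y) \<le> 1 \<and> (\<forall>u\<in>nb R S y. \<forall>w\<in>nb R S y. \<not> R u w))"
  shows "arcs R S + arcs M S \<le> 4 * card S"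
  using assms(1,6,7)
proof (induction S rule: finite_psubset_induct)
  case (psubset S)
  have fin: "finite S" and free: "path_free R S 6" by fact+
  have nbm: "nb Q (S - U) v \<subseteq> nb Q S v" for Q :: "'a \<Rightarrow> 'a \<Rightarrow> bool" and U v by (auto simp: nb_def)
  have nbmc: "card (nb Q (S - U) v) \<le> card (nb Q S v)" for Q :: "'a \<Rightarrow> 'a \<Rightarrow> bool" and U v
    using nbm fin by (simp add: card_mono)
  have MRn: "card (nb M S v) \<le> card (nb R S v)" for v
    using fin MR by (intro card_mono) (auto simp: nb_def)
  have IH: "arcs R (S - U) + arcs M (S - U) \<le> 4 * card (S - U)" if U: "U \<subseteq> S" "U \<noteq> {}" for U
  proof (rule psubset.IH)
    show "S - U \<subset> S" using U by auto
    show "path_free R (S - U) 6" using path_free_mono[OF free, of "S - U" R] by blast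
    fix y z assume yz: "y \<in> S - U" "z \<in> S - U" "M y z"
    then have "card (nb R S y) \<le> 2 \<or>
      (card (nb M S y) \<le> 1 \<and> (\<forall>u\<in>nb R S y. \<forall>w\<in>nb R S y. \<not> R u w))"
      using psubset.prems(2)[of y z] by blast
    then show "card (nb R (S - U) y) \<le> 2 \<or>
      (card (nb M (S - U) y) \<le> 1 \<and> (\<forall>u\<in>nb R (S - U) y. \<forall>w\<in>nb R (S - U) y. \<not> R u w))"
      using nbmc[of R U y] nbmc[of M U y] nbm[of R U y] by (meson le_trans subsetD)
  qed
  show ?case
  proof (cases "\<exists>v\<in>S. card (nb R S v) \<le> 1")
    case True
    then obtain v where v: "v \<in> S" "card (nb R S v) \<le> 1" by auto
    have "arcs R S \<le> arcs R (S - {v}) + 2" using arcs_remove[of S v R, OF fin v(1) sym irr] v(2) by simp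
    \<comment> \<open>Removing \<open>v\<close> costs at most two arcs in each relation, within the
      budget of four per vertex.\<close>
    moreover have "arcs M S \<le> arcs M (S - {v}) + 2"
    proof -
      have "\<not> M x x" for x using MR irr by blast
      then have "arcs M S = arcs M (S - {v}) + 2 * card (nb M S v)"
        using arcs_remove[of S v M, OF fin v(1) symM] by blast
      then show ?thesis using MRn[of v] v(2) by linarith
    qed
    moreover have "card S = card (S - {v}) + 1" using v fin by (metis Suc_eq_plus1 card_Suc_Diff1)
    ultimately show ?thesis using IH[of "{v}"] v by simp
  next
    case False
    then have deg: "2 \<le> card (nb R S v)" if "v \<in> S" for v using that by force
    show ?thesis
    proof (cases "\<exists>y\<in>S. 3 \<le> card (nb R S y) \<and> (\<exists>z\<in>S. M y z)")
      case True
      then obtain y z where y: "y \<in> S" "3 \<le> card (nb R S y)" "z \<in> S" "M y z" by auto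
      have yy: "card (nb M S y) \<le> 1" "\<And>u w. u \<in> nb R S y \<Longrightarrow> w \<in> nb R S y \<Longrightarrow> \<not> R u w"
        using psubset.prems(2)[OF y(1,3,4)] y(2) by auto
      define N where "N = nb R S y"
      obtain t where t: "t \<in> S" "t \<noteq> y" "t \<notin> N" "nb R S t = N" "\<And>u. u \<in> N \<Longrightarrow> nb R S u = {y, t}"
        using independent_nb_component[OF fin sym irr free deg y(1,2) yy(2)] unfolding N_def by blast
      have NS: "N \<subseteq> S" "y \<notin> N" "finite N" using fin irr by (auto simp: N_def nb_def)
      \<comment> \<open>\<open>t\<close> has the neighbours of \<open>y\<close>, hence degree at
        least three, so a marked edge at \<open>t\<close> falls under the second alternative of the
        hypothesis.\<close>
      have mt: "card (nb M S t) \<le> 1"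
      proof (cases "nb M S t = {}")
        case False
        then obtain s where "s \<in> S" "M t s" by (auto simp: nb_def)
        then show ?thesis using psubset.prems(2)[of t s] t y(2) by (auto simp: N_def)
      qed simp
      define U where "U = insert y (insert t N)"
      have US: "U \<subseteq> S" "U \<noteq> {}" "finite U" and cU: "card U = card N + 2"
        using t y NS by (auto simp: U_def)
      have closed: "w \<in> U" if "u \<in> U" "w \<in> S" "R u w" for u w
      proof -
        have "w \<in> nb R S u" using that by (auto simp: nb_def)
        moreover have "nb R S y = N" by (simp add: N_def)
        ultimately show ?thesis using that(1) t(4,5) unfolding U_def by fastforce
      qed
      have Q: "arcs Q U \<le> 2 * (card (nb Q S y) + card (nb Q S t))"
        if "\<And>x y. Q x y \<Longrightarrow> Q y x" "\<And>x y. Q x y \<Longrightarrow> R x y" for Q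
      proof -
        have "nb Q N u = {}" if "u \<in> N" for u
          using yy(2) that \<open>\<And>x y. Q x y \<Longrightarrow> R x y\<close> by (auto simp: nb_def N_def)
        then have "arcs Q N = 0" by (simp add: arcs_def)
        moreover have "U - {y, t} = N" using NS t by (auto simp: U_def)
        ultimately have "arcs Q U \<le> 2 * (\<Sum>u\<in>{y, t}. card (nb Q U u))"
          using arcs_remove_set[of U "{y, t}" Q, OF US(3) _ that(1)] by (simp add: U_def)
        also have "(\<Sum>u\<in>{y, t}. card (nb Q U u)) \<le> (\<Sum>u\<in>{y, t}. card (nb Q S u))"
          using US fin by (intro sum_mono card_mono) (auto simp: nb_def)
        finally show ?thesis using t by simp
      qed
      \<comment> \<open>The budget of \<open>U\<close> is \<open>4 * card N + 8\<close>; the arcs of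
        \<open>R\<close> take at most \<open>4 * card N\<close>, and the marked edges, at most one
        at \<open>y\<close> and one at \<open>t\<close>, take at most four.\<close>
      have "arcs R U \<le> 4 * card N" using Q[of R, OF sym] t by (simp add: N_def)
      moreover have "arcs M U \<le> 4"
      proof -
        have "arcs M U \<le> 2 * (card (nb M S y) + card (nb M S t))"
          by (rule Q) (auto intro: symM MR)
        also have "\<dots> \<le> 2 * (1 + 1)" using yy(1) mt by (intro mult_le_mono add_mono order_refl)
        finally show ?thesis by simp
      qed
      moreover have "arcs R S = arcs R (S - U) + arcs R U" "arcs M S = arcs M (S - U) + arcs M U"
        using arcs_split_closed[of S U R] arcs_split_closed[of S U M] fin US sym symM closed MR by blast+
      moreover have "card S = card (S - U) + card U"
        using US fin by (metis card_Diff_subset card_mono le_add_diff_inverse2)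
      ultimately show ?thesis using IH[OF US(1,2)] cU by simp
    next
      case False
      \<comment> \<open>All marked edges lie inside \<open>U\<close>, whose vertices now have degree
        at most two. So \<open>arcs M S\<close> is at most \<open>arcs R U\<close>, the very term
        that \<open>arcs_remove_set\<close> has on its left.\<close>
      define U where "U = {y \<in> S. \<exists>z\<in>S. M y z}"
      have US: "U \<subseteq> S" "finite U" using fin by (auto simp: U_def)
      have "card (nb R S u) \<le> 2" if "u \<in> U" for u
        using False that by (force simp: U_def)
      then have s2: "(\<Sum>u\<in>U. card (nb R S u)) \<le> 2 * card U"
        using sum_bounded_above[of U "\<lambda>u. card (nb R S u)" 2] by simp
      have "arcs M S = (\<Sum>u\<in>U. card (nb M U u))"
      proof -
        have "arcs M S = (\<Sum>u\<in>U. card (nb M S u))"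
          unfolding arcs_def by (rule sum.mono_neutral_right) (use fin in \<open>auto simp: U_def nb_def\<close>)
        moreover have "nb M S u = nb M U u" if "u \<in> U" for u
          using that symM by (fastforce simp: U_def nb_def)
        ultimately show ?thesis by simp
      qed
      also have "\<dots> \<le> arcs R U"
        unfolding arcs_def using US MR by (intro sum_mono card_mono) (auto simp: nb_def)
      finally have "arcs R S + arcs M S \<le> arcs R (S - U) + 4 * card U"
        using arcs_remove_set[of S U R, OF fin US(1) sym] s2 by linarith
      moreover have "arcs R (S - U) \<le> 4 * card (S - U)"
        using arcs_le_if_path_free_6[of "S - U" R] fin sym irr path_free_mono[OF free, of "S - U" R] by blast
      moreover have "card S = card (S - U) + card U"
        using US fin by (metis card_Diff_subset card_mono le_add_diff_inverse2)
      ultimately show ?thesis by simp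
    qed
  qed
qed

section \<open>Neighbourhoods of a vertex of large degree in a link\<close>

text \<open>Another edge at \<open>w\<close> would create a path on four vertices ending in
  \<open>z\<close>. Two elements of \<open>X\<close> off that path either extend it to six vertices
  or have enough neighbours on it to be threaded into it. Five is three path vertices besides
  \<open>z\<close> plus these two.\<close>

lemma nb_legs_if_path_free_6:
  assumes fin: "finite S" and sym: "\<And>x y. R x y \<Longrightarrow> R y x" and irr: "\<And>x. \<not> R x x"
    and free: "path_free R S 6" and z: "z \<in> S"
    and five: "5 \<le> card {x \<in> nb R S z. 3 \<le> card (nb R S x)}"
    and x: "x \<in> nb R S z" "3 \<le> card (nb R S x)" and w: "w \<in> nb R S x" "w \<noteq> z"
  shows "nb R S w = {x}"
proof -
  have symi: "R a b = R b a" for a b using sym by blast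
  define X where "X = {x \<in> nb R S z. 3 \<le> card (nb R S x)}"
  note n6 = no_path_6[OF free]
  have no3: False if p: "distinct [p1, p2, p3, z]" "{p1, p2, p3} \<subseteq> S" "R p1 p2" "R p2 p3" "R p3 z" for p1 p2 p3
  proof -
    have "card {p1, p2, p3} \<le> 3" by (simp add: card_insert_le_m1)
    then have "2 \<le> card (X - {p1, p2, p3})"
      using five diff_card_le_card_Diff[of "{p1, p2, p3}" X] by (simp add: X_def)
    then obtain W where W: "W \<subseteq> X - {p1, p2, p3}" "card W = 2"
      by (meson obtain_subset_with_card_n)
    then obtain x2 x3 where x23: "x2 \<in> X - {p1, p2, p3}" "x3 \<in> X - {p1, p2, p3}" "x2 \<noteq> x3"
      by (auto simp: card_2_iff)
    have inS: "x2 \<in> S" "x3 \<in> S" "R z x2" "R z x3" "R x2 z" "R x3 z" "x2 \<noteq> z" "x3 \<noteq> z"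
      using x23 irr symi[of z] by (auto simp: X_def nb_def)
    have R': "R p2 p1" "R p3 p2" using p sym by blast+
    have sub: "nb R S v \<subseteq> {z, p1, p2, p3}" if "v \<in> {x2, x3}" for v
    proof (rule ccontr)
      assume "\<not> ?thesis"
      then obtain q where "q \<in> S" "R v q" "q \<notin> {z, p1, p2, p3}" by (auto simp: nb_def)
      then show False using n6[of p1 p2 p3 z v q] that x23 p inS z irr by auto
    qed
    have np1: "\<not> R v p1" if "v \<in> {x2, x3}" for v
    proof
      assume a: "R v p1"
      then show False
        using n6[of p3 p2 p1 v z "if v = x2 then x3 else x2"] sym[OF a] that x23 p inS z R' by (auto split: if_splits)
    qed
    \<comment> \<open>After \<open>sub\<close> and \<open>np1\<close> only \<open>z\<close>,
      \<open>p2\<close>, \<open>p3\<close> are left as neighbours of \<open>v\<close>, and its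
      degree is at least three.\<close>
    have full: "R v p2 \<and> R v p3" if "v \<in> {x2, x3}" for v
    proof (rule ccontr)
      assume "\<not> ?thesis"
      then have "nb R S v \<subseteq> {z, p2} \<or> nb R S v \<subseteq> {z, p3}"
        using sub[OF that] np1[OF that] by (auto simp: nb_def)
      moreover have "card {z, a} \<le> 2" for a by (simp add: card_insert_le_m1)
      moreover have "card (nb R S v) \<le> card {z, a}" if "nb R S v \<subseteq> {z, a}" for a
        using that by (intro card_mono) auto
      ultimately have "card (nb R S v) \<le> 2" by (meson le_trans)
      then show False using that x23 by (auto simp: X_def)
    qed
    then show False
      using n6[of p1 p2 x2 p3 x3 z] sym[of x2 p2] sym[of x3 p3] x23 p inS z by auto
  qed
  have xS: "x \<in> S" "R z x" "x \<noteq> z" "w \<in> S" "R x w" "w \<noteq> x" "R x z" "R w x"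
    using x w irr symi[of x] by (auto simp: nb_def)
  have "q = x" if q: "q \<in> S" "R w q" for q
  proof (rule ccontr)
    assume "q \<noteq> x"
    show False
    proof (cases "q = z")
      \<comment> \<open>In the triangle x w z a third neighbour \<open>w2\<close> of
        \<open>x\<close> starts the excluded path w2 x w z.\<close>
      case True
      have "\<not> nb R S x \<subseteq> {z, w}" using x(2) card_mono[of "{z, w}" "nb R S x"] w by auto
      then obtain w2 where "w2 \<in> S" "R x w2" "w2 \<noteq> z" "w2 \<noteq> w" by (auto simp: nb_def)
      then show False using no3[of w2 x w] xS w q True sym[of x w2] irr by auto
    next
      case False
      then show False using no3[of q w x] xS w q sym[of w q] irr \<open>q \<noteq> x\<close> by auto
    qed
  qed
  then show ?thesis using xS(1,8) unfolding nb_def by blast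
qed

text \<open>A non-leaf \<open>x1\<close> has a neighbour \<open>w1\<close> besides \<open>z\<close>,
  and only \<open>w1\<close> can be a second non-leaf. Degree four supplies a neighbour
  \<open>z'\<close> of \<open>z\<close> outside \<open>{x1, w1, x2}\<close> for two of the three
  paths that exclude any other \<open>x2\<close>.\<close>

lemma card_nonleaf_nb_if_path_free_5:
  assumes fin: "finite S" and sym: "\<And>x y. R x y \<Longrightarrow> R y x" and irr: "\<And>x. \<not> R x x"
    and free: "path_free R S 5" and z: "z \<in> S" "4 \<le> card (nb R S z)"
  shows "card {x \<in> nb R S z. 2 \<le> card (nb R S x)} \<le> 2"
proof -
  have symi: "R a b = R b a" for a b using sym by blast
  define X where "X = {x \<in> nb R S z. 2 \<le> card (nb R S x)}"
  have n5: False if "distinct [a, b, c, d, e]" "{a, b, c, d, e} \<subseteq> S" "R a b" "R b c" "R c d" "R d e" for a b c d e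
  proof -
    have "path_in R S [a, b, c, d, e]" using that by (simp add: path_in_def)
    then show False using free by (auto simp: path_free_def)
  qed
  show ?thesis
  proof (cases "X = {}")
    case True
    then show ?thesis by (simp flip: X_def)
  next
    case False
    then obtain x1 where x1: "x1 \<in> X" by auto
    then obtain w1 where w1: "w1 \<in> S" "R x1 w1" "w1 \<noteq> z"
      using exists_other_nb[of R S x1] by (auto simp: X_def)
    have x1': "x1 \<in> S" "R z x1" "x1 \<noteq> z" "R x1 z" "w1 \<noteq> x1" "R w1 x1"
      using x1 w1 irr symi[of z] symi[of w1] by (auto simp: X_def nb_def)
    have "X \<subseteq> {x1, w1}"
    proof (rule ccontr)
      assume "\<not> ?thesis"
      then obtain x2 where x2: "x2 \<in> X" "x2 \<noteq> x1" "x2 \<noteq> w1" by auto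
      then obtain w2 where w2: "w2 \<in> S" "R x2 w2" "w2 \<noteq> z"
        using exists_other_nb[of R S x2] by (auto simp: X_def)
      have x2': "x2 \<in> S" "R z x2" "x2 \<noteq> z" "R x2 z" "w2 \<noteq> x2" "R w2 x2"
        using x2 w2 irr symi[of z] symi[of w2] by (auto simp: X_def nb_def)
      have "card {x1, w1, x2} \<le> 3" by (simp add: card_insert_le_m1)
      then have "card {x1, w1, x2} < card (nb R S z)" using z(2) by linarith
      then have "\<not> nb R S z \<subseteq> {x1, w1, x2}" using card_mono[of "{x1, w1, x2}" "nb R S z"] by auto
      then obtain z' where z': "z' \<in> S" "R z z'" "z' \<notin> {x1, w1, x2}" by (auto simp: nb_def)
      have z'': "z' \<noteq> z" "R z' z" using z' irr symi[of z] by auto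
      consider "w2 = w1" | "w2 = x1" | "w2 \<noteq> w1" "w2 \<noteq> x1" by blast
      then show False
      proof cases
        case 1
        then show False using n5[of z' z x1 w1 x2] z z' z'' x1' x2' x2 w1 w2 by auto
      next
        case 2
        then show False using n5[of w1 x1 x2 z z'] z z' z'' x1' x2' x2 w1 w2 by auto
      next
        case 3
        then show False using n5[of w1 x1 z x2 w2] z x1' x2' x2 w1 w2 by auto
      qed
    qed
    then have "card X \<le> card {x1, w1}" by (intro card_mono) auto
    also have "\<dots> \<le> 2" by (simp add: card_insert_le_m1)
    finally show ?thesis by (simp add: X_def)
  qed
qed

lemma card_nb_le_1_if_path_free_4:
  assumes fin: "finite S" and sym: "\<And>x y. R x y \<Longrightarrow> R y x" and irr: "\<And>x. \<not> R x x"
    and free: "path_free R S 4" and z: "z \<in> S" "3 \<le> card (nb R S z)" and x: "x \<in> nb R S z"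
  shows "card (nb R S x) \<le> 1"
proof (rule ccontr)
  assume "\<not> ?thesis"
  have symi: "R a b = R b a" for a b using sym by blast
  from \<open>\<not> card (nb R S x) \<le> 1\<close> obtain w where w: "w \<in> S" "R x w" "w \<noteq> z" using exists_other_nb[of R S x z] by auto
  have "\<not> nb R S z \<subseteq> {x, w}" using z(2) card_mono[of "{x, w}" "nb R S z"] card_insert_le_m1[of 2 "{w}" x] by auto
  then obtain z' where "z' \<in> S" "R z z'" "z' \<notin> {x, w}" by (auto simp: nb_def)
  moreover from this have "z' \<noteq> z" "x \<noteq> z" "w \<noteq> x" "R w x" "R x z" "x \<in> S"
    using x w irr symi[of z] symi[of w] by (auto simp: nb_def)
  ultimately have "path_in R S [w, x, z, z']"
    using w z by (auto simp: path_in_def)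
  then show False using free by (auto simp: path_free_def)
qed

section \<open>Degrees, codegrees and triangles\<close>

locale fin_graph =
  fixes V :: "'a set" and E :: "'a \<Rightarrow> 'a \<Rightarrow> bool"
  assumes finV: "finite V" and sym: "E x y \<Longrightarrow> E y x" and irr: "\<not> E x x" and EV: "E x y \<Longrightarrow> x \<in> V"
begin

abbreviation N :: "'a \<Rightarrow> 'a set" where "N \<equiv> nb E V"

definition deg :: "'a \<Rightarrow> nat" where "deg x = card (N x)"

definition codeg :: "'a \<Rightarrow> 'a \<Rightarrow> nat" where "codeg x y = card (N x \<inter> N y)"

definition tri :: "'a \<Rightarrow> 'a \<Rightarrow> 'a \<Rightarrow> bool" where "tri x y z \<longleftrightarrow> E x y \<and> E x z \<and> E y z"

text \<open>Ordered, so that \<open>Q\<close> can treat its first argument as the apex; a triangle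
  gives six elements of \<open>triples tri\<close>.\<close>

definition triples :: "('a \<Rightarrow> 'a \<Rightarrow> 'a \<Rightarrow> bool) \<Rightarrow> ('a \<times> 'a \<times> 'a) set" where
  "triples Q = {(x, y, z). Q x y z}"

lemma symi: "E x y = E y x" using sym by blast

lemma in_N [simp]: "y \<in> N x \<longleftrightarrow> E x y"
  using EV[of y x] by (auto simp: nb_def symi)

lemma N_subset: "N x \<subseteq> V" by (auto simp: nb_def)

lemma finite_N [simp]: "finite (N x)" using finV by simp

lemma finite_nbs [simp]: "finite {z. E y z \<and> P z}"
  by (rule finite_subset[of _ "N y"]) auto

lemma codeg_commute: "codeg x y = codeg y x" by (simp add: codeg_def Int_commute)

lemma deg_le: "deg x \<le> card V" unfolding deg_def using finV by (rule card_nb_le)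

lemma card_nb_link: "card (nb E (N x) y) = codeg x y"
proof -
  have "nb E (N x) y = N x \<inter> N y" by (auto simp: nb_def)
  then show ?thesis by (simp add: codeg_def)
qed

lemma arcs_link: "arcs E (N x) = (\<Sum>y\<in>N x. codeg x y)"
  by (simp add: arcs_def card_nb_link)

lemma triE: "tri x y z \<Longrightarrow> tri x z y \<and> tri y x z"
  by (simp add: tri_def symi)

lemma triples_eq_Sigma:
  assumes "\<And>x y z. Q x y z \<Longrightarrow> tri x y z"
  shows "triples Q = Sigma V (\<lambda>x. Sigma (N x) (\<lambda>y. nb (Q x) (N x) y))"
proof -
  have "Q x y z \<longleftrightarrow> x \<in> V \<and> y \<in> V \<and> z \<in> V \<and> E x y \<and> E x z \<and> Q x y z" for x y z
    using assms[of x y z] EV[of x y] EV[of y x] EV[of z x] by (auto simp: tri_def symi)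
  then show ?thesis unfolding triples_def nb_def by blast
qed

lemma finite_triples: "(\<And>x y z. Q x y z \<Longrightarrow> tri x y z) \<Longrightarrow> finite (triples Q)"
  using finV by (simp add: triples_eq_Sigma)

text \<open>The pairs completing \<open>x\<close> to a triple of \<open>Q\<close> are the arcs of
  the relation \<open>Q x\<close> on the link of \<open>x\<close>.\<close>

lemma sum_triples:
  fixes f :: "'a \<Rightarrow> real"
  assumes "\<And>x y z. Q x y z \<Longrightarrow> tri x y z"
  shows "(\<Sum>(x, y, z)\<in>triples Q. f x) = (\<Sum>x\<in>V. f x * arcs (Q x) (N x))"
proof -
  have "(\<Sum>(x, y, z)\<in>triples Q. f x) = (\<Sum>x\<in>V. \<Sum>(y, z)\<in>Sigma (N x) (\<lambda>y. nb (Q x) (N x) y). f x)"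
  proof -
    have eq: "triples Q = Sigma V (\<lambda>x. Sigma (N x) (\<lambda>y. nb (Q x) (N x) y))"
      by (rule triples_eq_Sigma) (rule assms)
    show ?thesis unfolding eq using finV by (subst sum.Sigma) auto
  qed
  also have "\<dots> = (\<Sum>x\<in>V. f x * card (Sigma (N x) (\<lambda>y. nb (Q x) (N x) y)))"
    by (simp add: case_prod_unfold mult.commute)
  also have "\<dots> = (\<Sum>x\<in>V. f x * arcs (Q x) (N x))"
    using finV by (intro sum.cong refl) (simp add: arcs_def card_SigmaI)
  finally show ?thesis .
qed

lemma card_triples:
  assumes "\<And>x y z. Q x y z \<Longrightarrow> tri x y z"
  shows "card (triples Q) = (\<Sum>x\<in>V. arcs (Q x) (N x))"
proof -
  have "real (card (triples Q)) = (\<Sum>(x, y, z)\<in>triples Q. 1)" by (simp add: case_prod_unfold)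
  also have "\<dots> = real (\<Sum>x\<in>V. arcs (Q x) (N x))"
    using sum_triples[of Q "\<lambda>_. 1", OF assms] by simp
  finally show ?thesis by linarith
qed

lemma sum_triples_swap:
  "(\<Sum>(x, y, z)\<in>triples Q. f x y z) = (\<Sum>(y, x, z)\<in>triples (\<lambda>y x z. Q x y z). f x y z)"
  by (rule sum.reindex_bij_witness[of _ "\<lambda>(y, x, z). (x, y, z)" "\<lambda>(x, y, z). (y, x, z)"])
    (auto simp: triples_def)

lemma sum_triples_swap':
  "(\<Sum>(x, y, z)\<in>triples Q. f x y z) = (\<Sum>(x, z, y)\<in>triples (\<lambda>x z y. Q x y z). f x y z)"
  by (rule sum.reindex_bij_witness[of _ "\<lambda>(x, z, y). (x, y, z)" "\<lambda>(x, y, z). (x, z, y)"])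
    (auto simp: triples_def)

lemma card_triples_swap: "card (triples Q) = card (triples (\<lambda>y x z. Q x y z))"
  using sum_triples_swap[of "\<lambda>_ _ _. 1 :: nat" Q] by (simp add: case_prod_unfold)

lemma card_triples_swap': "card (triples Q) = card (triples (\<lambda>x z y. Q x y z))"
  using sum_triples_swap'[of "\<lambda>_ _ _. 1 :: nat" Q] by (simp add: case_prod_unfold)

lemma sum_triples_snd:
  fixes f :: "'a \<Rightarrow> real"
  assumes "\<And>x y z. Q x y z \<Longrightarrow> tri x y z"
  shows "(\<Sum>(x, y, z)\<in>triples Q. f y) = (\<Sum>y\<in>V. f y * arcs (\<lambda>x z. Q x y z) (N y))"
  using sum_triples_swap[of "\<lambda>x y z. f y" Q] sum_triples[of "\<lambda>y x z. Q x y z" f] assms triE by metis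

lemma sum_triples_thd:
  fixes f :: "'a \<Rightarrow> real"
  assumes "\<And>x y z. Q x y z \<Longrightarrow> tri x y z"
  shows "(\<Sum>(x, y, z)\<in>triples Q. f z) = (\<Sum>z\<in>V. f z * arcs (\<lambda>x y. Q x y z) (N z))"
  using sum_triples_swap'[of "\<lambda>x y z. f z" Q] sum_triples_snd[of "\<lambda>x z y. Q x y z" f] assms triE by metis

lemma card_triples_le_arcs:
  assumes "\<And>x. x \<in> V \<Longrightarrow> arcs E (N x) \<le> m * deg x"
  shows "card (triples tri) \<le> m * card V * card V"
proof -
  have "arcs (tri x) (N x) = arcs E (N x)" for x
  proof -
    have "nb (tri x) (N x) y = nb E (N x) y" if "y \<in> N x" for y
      using that by (auto simp: nb_def tri_def)
    then show ?thesis by (simp add: arcs_def)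
  qed
  then have "card (triples tri) = (\<Sum>x\<in>V. arcs E (N x))" by (simp add: card_triples)
  also have "\<dots> \<le> (\<Sum>x\<in>V. m * card V)"
    using assms deg_le by (intro sum_mono) (meson le_trans mult_le_mono2)
  finally show ?thesis by (simp add: ac_simps)
qed

lemma deg_pair_le: "deg x + deg y \<le> card V + codeg x y"
proof -
  have "deg x + deg y = card (N x \<union> N y) + codeg x y"
    unfolding deg_def codeg_def by (rule card_Un_Int) auto
  also have "card (N x \<union> N y) \<le> card V" using finV N_subset by (intro card_mono) auto
  finally show ?thesis by simp
qed

text \<open>A vertex $v$ counted too often on the left is adjacent to both ends of one of the pairs on the right.\<close>

lemma deg_triangle_le:
  assumes "finite U" "card U \<le> 2"
  shows "2 * (deg x + deg y + deg z) + (\<Sum>u\<in>U. deg u) \<le>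
    2 * card V + 2 * (codeg x y + codeg x z + codeg y z) + (\<Sum>u\<in>U. codeg x u + codeg y u + codeg z u)"
proof -
  have d: "deg a = (\<Sum>v\<in>V. of_bool (E a v))" for a
    unfolding deg_def using finV by (rule card_nb_of_bool)
  have c: "codeg a b = (\<Sum>v\<in>V. of_bool (E a v \<and> E b v))" for a b
  proof -
    have "N a \<inter> N b = nb (\<lambda>_ v. E a v \<and> E b v) V a" unfolding nb_def by blast
    then show ?thesis unfolding codeg_def using card_nb_of_bool[OF finV] by metis
  qed
  have pt: "2 * (of_bool (E x v) + of_bool (E y v) + of_bool (E z v)) + (\<Sum>u\<in>U. of_bool (E u v)) \<le>
      2 + 2 * (of_bool (E x v \<and> E y v) + of_bool (E x v \<and> E z v) + of_bool (E y v \<and> E z v))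
      + (\<Sum>u\<in>U. of_bool (E x v \<and> E u v) + of_bool (E y v \<and> E u v) + of_bool (E z v \<and> E u v) :: nat)" for v
  proof (cases "E x v \<or> E y v \<or> E z v")
    case True
    then have "(\<Sum>u\<in>U. of_bool (E u v) :: nat)
        \<le> (\<Sum>u\<in>U. of_bool (E x v \<and> E u v) + of_bool (E y v \<and> E u v) + of_bool (E z v \<and> E u v))"
      by (intro sum_mono) auto
    moreover have "2 * (of_bool (E x v) + of_bool (E y v) + of_bool (E z v)) \<le>
      2 + 2 * (of_bool (E x v \<and> E y v) + of_bool (E x v \<and> E z v) + of_bool (E y v \<and> E z v) :: nat)"
      using True by auto
    ultimately show ?thesis by linarith
  next
    \<comment> \<open>Here \<open>v\<close> is adjacent to none of x, y, z; the constant 2 on the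
      right absorbs its at most \<open>card U\<close> occurrences on the left.\<close>
    case False
    have "(\<Sum>u\<in>U. of_bool (E u v) :: nat) \<le> (\<Sum>u\<in>U. 1)" by (intro sum_mono) auto
    then show ?thesis using assms False by simp
  qed
  have "2 * (deg x + deg y + deg z) + (\<Sum>u\<in>U. deg u)
      = (\<Sum>v\<in>V. 2 * (of_bool (E x v) + of_bool (E y v) + of_bool (E z v)) + (\<Sum>u\<in>U. of_bool (E u v)))"
    unfolding d sum.distrib sum_distrib_left[symmetric] by (subst (2) sum.swap) simp
  also have "\<dots> \<le> (\<Sum>v\<in>V. 2 + 2 * (of_bool (E x v \<and> E y v) + of_bool (E x v \<and> E z v) + of_bool (E y v \<and> E z v))
      + (\<Sum>u\<in>U. of_bool (E x v \<and> E u v) + of_bool (E y v \<and> E u v) + of_bool (E z v \<and> E u v)))"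
    by (intro sum_mono pt)
  also have "\<dots> = 2 * card V + 2 * (codeg x y + codeg x z + codeg y z)
      + (\<Sum>u\<in>U. codeg x u + codeg y u + codeg z u)"
  proof -
    have "(\<Sum>u\<in>U. codeg x u + codeg y u + codeg z u) = (\<Sum>v\<in>V. \<Sum>u\<in>U.
      of_bool (E x v \<and> E u v) + of_bool (E y v \<and> E u v) + of_bool (E z v \<and> E u v))"
      unfolding c sum.distrib[symmetric] by (rule sum.swap)
    moreover have "(\<Sum>v\<in>V. 2 :: nat) = 2 * card V" by simp
    ultimately show ?thesis by (simp only: c sum.distrib sum_distrib_left distrib_left)
  qed
  finally show ?thesis .
qed

section \<open>Light triangles and heavy edges\<close>

definition light :: "nat \<Rightarrow> 'a \<Rightarrow> 'a \<Rightarrow> 'a \<Rightarrow> bool" where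
  "light C x y z \<longleftrightarrow> tri x y z \<and> codeg x y \<le> C \<and> codeg x z \<le> C \<and> codeg y z \<le> C"

text \<open>The heavy edge is opposite the apex \<open>x\<close>; the other two edges may be heavy
  as well.\<close>

definition heavy_base :: "nat \<Rightarrow> 'a \<Rightarrow> 'a \<Rightarrow> 'a \<Rightarrow> bool" where
  "heavy_base C x y z \<longleftrightarrow> tri x y z \<and> C < codeg y z"

lemma light_tri: "light C x y z \<Longrightarrow> tri x y z" by (simp add: light_def)

lemma light_swap: "light C x y z \<longleftrightarrow> light C x z y" "light C x y z \<longleftrightarrow> light C y x z"
  by (auto simp: light_def tri_def symi codeg_commute)

lemma card_triples_le_light_heavy:
  "card (triples tri) \<le> card (triples (light C)) + 3 * card (triples (heavy_base C))"
proof -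
  let ?Q = "\<lambda>x y z. heavy_base C y x z" let ?Q' = "\<lambda>x y z. heavy_base C z x y"
  have fin: "finite (triples (light C))" "finite (triples (heavy_base C))" "finite (triples ?Q)" "finite (triples ?Q')"
    by (rule finite_triples; simp add: light_def heavy_base_def tri_def symi)+
  have "triples tri \<subseteq> triples (light C) \<union> triples (heavy_base C) \<union> triples ?Q \<union> triples ?Q'"
    by (auto simp: triples_def light_def heavy_base_def tri_def symi codeg_commute)
  then have "card (triples tri) \<le> card (triples (light C) \<union> triples (heavy_base C) \<union> triples ?Q \<union> triples ?Q')"
    using fin by (intro card_mono) auto
  also have "\<dots> \<le> card (triples (light C)) + card (triples (heavy_base C)) + card (triples ?Q) + card (triples ?Q')"
    by (intro order_trans[OF card_Un_le] add_mono order_refl)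
  also have "card (triples ?Q) = card (triples (heavy_base C))"
    using card_triples_swap[of "heavy_base C"] by simp
  also have "card (triples ?Q') = card (triples (heavy_base C))"
    using card_triples_swap[of "heavy_base C"] card_triples_swap'[of "\<lambda>y x z. heavy_base C x y z"] by simp
  finally show ?thesis by simp
qed

definition heavy_pairs :: "nat \<Rightarrow> ('a \<times> 'a) set" where
  "heavy_pairs C = {(y, z). E y z \<and> C < codeg y z}"

lemma heavy_pairs_eq_Sigma: "heavy_pairs C = Sigma V (\<lambda>y. {z \<in> N y. C < codeg y z})"
  using EV by (auto simp: heavy_pairs_def)

lemma finite_heavy_pairs: "finite (heavy_pairs C)"
  using finV by (simp add: heavy_pairs_eq_Sigma)

text \<open>Markov's inequality for the codegrees at \<open>y\<close>, whose sum is the number of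
  arcs of its link.\<close>

lemma card_heavy_nbs_le: "Suc C * card {z \<in> N y. C < codeg y z} \<le> arcs E (N y)"
proof -
  have "Suc C * card {z \<in> N y. C < codeg y z} = (\<Sum>z\<in>{z \<in> N y. C < codeg y z}. Suc C)" by simp
  also have "\<dots> \<le> (\<Sum>z\<in>{z \<in> N y. C < codeg y z}. codeg y z)" by (rule sum_mono) auto
  also have "\<dots> \<le> arcs E (N y)" unfolding arcs_link by (rule sum_mono2) auto
  finally show ?thesis .
qed

lemma card_heavy_pairs_le:
  assumes "\<And>x. x \<in> V \<Longrightarrow> arcs E (N x) \<le> m * deg x"
  shows "Suc C * card (heavy_pairs C) \<le> m * card V * card V"
proof -
  have "Suc C * card (heavy_pairs C) = (\<Sum>y\<in>V. Suc C * card {z \<in> N y. C < codeg y z})"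
    using finV by (simp add: heavy_pairs_eq_Sigma sum_distrib_left)
  also have "\<dots> \<le> (\<Sum>y\<in>V. m * card V)"
    using card_heavy_nbs_le assms deg_le by (intro sum_mono) (meson le_trans mult_le_mono2)
  finally show ?thesis by (simp add: ac_simps)
qed

lemma card_heavy_base_le:
  assumes "\<And>y z. E y z \<Longrightarrow> C < codeg y z \<Longrightarrow> card {x. tri x y z \<and> P x y z} \<le> m"
  shows "card (triples (\<lambda>x y z. heavy_base C x y z \<and> P x y z)) \<le> m * card (heavy_pairs C)"
proof -
  let ?W = "\<lambda>p. {x. tri x (fst p) (snd p) \<and> P x (fst p) (snd p)}"
  have fW: "finite (?W p)" for p
    using finite_subset[of "?W p" V] finV EV by (auto simp: tri_def)
  have eq: "triples (\<lambda>x y z. heavy_base C x y z \<and> P x y z)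
      = (\<lambda>(p, x). (x, fst p, snd p)) ` Sigma (heavy_pairs C) ?W"
    by (auto simp: triples_def heavy_base_def heavy_pairs_def tri_def image_iff)
  have "finite (Sigma (heavy_pairs C) ?W)"
    by (rule finite_SigmaI[OF finite_heavy_pairs fW])
  then have "card (triples (\<lambda>x y z. heavy_base C x y z \<and> P x y z)) \<le> card (Sigma (heavy_pairs C) ?W)"
    unfolding eq by (rule card_image_le)
  also have "\<dots> = (\<Sum>p\<in>heavy_pairs C. card (?W p))"
    using finite_heavy_pairs fW by (simp add: card_SigmaI)
  also have "\<dots> \<le> (\<Sum>p\<in>heavy_pairs C. m)"
    using assms by (intro sum_mono) (auto simp: heavy_pairs_def)
  finally show ?thesis by (simp add: mult.commute)
qed

end

section \<open>Upper bounds\<close>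

lemma arcs_converse: "finite S \<Longrightarrow> arcs (\<lambda>a b. R b a) S = arcs R S"
  unfolding arcs_def by (simp only: card_nb_of_bool) (rule sum.swap)

lemma arcs_eq_0:
  assumes "\<And>x y. x \<in> S \<Longrightarrow> y \<in> S \<Longrightarrow> \<not> R x y"
  shows "arcs R S = 0"
proof -
  have "nb R S v = {}" if "v \<in> S" for v using assms that by (auto simp: nb_def)
  then show ?thesis by (simp add: arcs_def)
qed

lemma arcs_le_card:
  assumes "finite S" "\<And>y. y \<in> S \<Longrightarrow> nb R S y \<noteq> {} \<Longrightarrow> y \<in> D" "\<And>y. y \<in> S \<Longrightarrow> card (nb R S y) \<le> 1"
  shows "arcs R S \<le> card (S \<inter> D)"
proof -
  have "arcs R S \<le> (\<Sum>y\<in>S. of_bool (y \<in> D))"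
    unfolding arcs_def using assms(2,3) by (intro sum_mono) force
  then show ?thesis using assms(1) by (simp add: Int_def)
qed

text \<open>Completing the square gives \<open>n * r \<le> 2 * r\<^sup>2 + n\<^sup>2 / 8\<close>,
  and the identity exhibits the slack between \<open>2 * r\<^sup>2\<close> and the degree term. This
  slack vanishes for \<open>l = b = 0\<close>, and also for \<open>a = 0\<close>,
  \<open>b = l / 3\<close>, the case of links made of K_4.\<close>

lemma quadratic_bound_one:
  fixes a l b d n :: real
  assumes "0 \<le> a" "0 \<le> b" "3 * b \<le> l" "a + l \<le> d + b"
  shows "n * (a / 2 + 2 * l / 3) - d * (a / 2 + l + b) \<le> n\<^sup>2 / 8"
proof -
  define r where "r = a / 2 + 2 * l / 3"
  have "0 \<le> (4 * r - n)\<^sup>2" by simp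
  then have 1: "n * r \<le> 2 * r\<^sup>2 + n\<^sup>2 / 8" by (simp add: power2_eq_square algebra_simps)
  have "2 * r\<^sup>2 + a * (l / 6 + b / 2) + (l / 3 - b) * (l / 3 + b) = (a + l - b) * (a / 2 + l + b)"
    by (simp add: r_def power2_eq_square field_simps)
  moreover have "0 \<le> a * (l / 6 + b / 2)" "0 \<le> (l / 3 - b) * (l / 3 + b)"
    using assms by auto
  moreover have "(a + l - b) * (a / 2 + l + b) \<le> d * (a / 2 + l + b)"
    using assms by (intro mult_right_mono) auto
  ultimately show ?thesis using 1 unfolding r_def by linarith
qed

text \<open>\<open>53 / 75\<close> is \<open>2 * (1 / 6 + 14 / 75)\<close>, where
  \<open>14 / 75\<close> is the loss of light triangles at threshold n/25. The coefficient of
  \<open>l\<^sup>2\<close> works because \<open>(53 / 75)\<^sup>2 < 1 / 2\<close>; 25 is the least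
  integer for which the weight obtained in this way stays below that limit.\<close>

lemma quadratic_bound_two:
  fixes a l d n :: real
  assumes "0 \<le> a" "0 \<le> l" "a + l / 2 \<le> d"
  shows "n * (a + 53 * l / 75) - d * (a + l) \<le> n\<^sup>2 / 4"
proof -
  define r where "r = a + 53 * l / 75"
  have "0 \<le> (2 * r - n)\<^sup>2" by simp
  then have 1: "n * r \<le> r\<^sup>2 + n\<^sup>2 / 4" by (simp add: power2_eq_square algebra_simps)
  have "r\<^sup>2 + 13 / 150 * (a * l) + 7 / 11250 * l\<^sup>2 = (a + l / 2) * (a + l)"
    by (simp add: r_def power2_eq_square field_simps)
  moreover have "0 \<le> a * l" using assms by simp
  moreover have "(a + l / 2) * (a + l) \<le> d * (a + l)"
    using assms by (intro mult_right_mono) auto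
  moreover have "0 \<le> l\<^sup>2" by simp
  ultimately show ?thesis using 1 unfolding r_def by linarith
qed

context fin_graph
begin

section \<open>Double counting of degrees over triangles\<close>

lemma sum_deg_light:
  "(\<Sum>(x, y, z)\<in>triples (light C). real (deg x + deg y + deg z))
    = 3 * (\<Sum>v\<in>V. real (deg v) * arcs (light C v) (N v))"
proof -
  have "(\<Sum>(x, y, z)\<in>triples (light C). real (deg y)) = (\<Sum>v\<in>V. real (deg v) * arcs (light C v) (N v))"
    using sum_triples_snd[of "light C" "\<lambda>v. real (deg v)", OF light_tri] by (simp flip: light_swap(2))
  moreover have "(\<Sum>(x, y, z)\<in>triples (light C). real (deg z)) = (\<Sum>v\<in>V. real (deg v) * arcs (light C v) (N v))"
  proof -
    have "(\<lambda>x y. light C x y z) = light C z" for z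
      using light_swap by blast
    then show ?thesis using sum_triples_thd[of "light C" "\<lambda>v. real (deg v)", OF light_tri] by simp
  qed
  moreover have "(\<Sum>(x, y, z)\<in>triples (light C). real (deg x)) = (\<Sum>v\<in>V. real (deg v) * arcs (light C v) (N v))"
    by (rule sum_triples) (rule light_tri)
  ultimately show ?thesis by (simp add: case_prod_unfold sum.distrib)
qed

lemma sum_deg_pair:
  assumes "\<And>x y z. Q x y z \<Longrightarrow> tri x y z"
  shows "(\<Sum>(x, y, z)\<in>triples Q. real (deg x + deg y))
    = (\<Sum>v\<in>V. real (deg v) * (arcs (Q v) (N v) + arcs (\<lambda>x z. Q x v z) (N v)))"
  using sum_triples[of Q "\<lambda>v. real (deg v)", OF assms] sum_triples_snd[of Q "\<lambda>v. real (deg v)", OF assms]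
  by (simp add: case_prod_unfold sum.distrib distrib_left)

lemma card_triples_twice:
  assumes "\<And>x y z. Q x y z \<Longrightarrow> tri x y z"
  shows "2 * real (card (triples Q)) = (\<Sum>v\<in>V. real (arcs (Q v) (N v) + arcs (\<lambda>x z. Q x v z) (N v)))"
proof -
  have "card (triples Q) = (\<Sum>v\<in>V. arcs (\<lambda>x z. Q x v z) (N v))"
  proof -
    have "Q y x z \<Longrightarrow> tri x y z" for x y z using assms triE by blast
    then have "card (triples (\<lambda>y x z. Q x y z)) = (\<Sum>v\<in>V. arcs (\<lambda>x z. Q x v z) (N v))"
      by (rule card_triples)
    then show ?thesis by (rule trans[OF card_triples_swap])
  qed
  moreover have "card (triples Q) = (\<Sum>v\<in>V. arcs (Q v) (N v))" by (rule card_triples) (rule assms)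
  ultimately have "2 * card (triples Q) = (\<Sum>v\<in>V. arcs (Q v) (N v) + arcs (\<lambda>x z. Q x v z) (N v))"
    by (simp add: sum.distrib)
  then show ?thesis by (metis of_nat_mult of_nat_numeral of_nat_sum)
qed

lemma light_irr: "\<not> light C x y y"
  using irr by (simp add: light_def tri_def)

lemma light_path_free: "path_free E (N x) r \<Longrightarrow> S \<subseteq> N x \<Longrightarrow> path_free (light C x) S r"
  by (rule path_free_mono[of E "N x" r S "light C x"]) (auto simp: light_def tri_def)

text \<open>Both sides count copies of K_4 with all four triangles light and one vertex
  \<open>u\<close> singled out: the other three vertices form a light triangle, and a triangle of
  the light link of \<open>u\<close>.\<close>

lemma sum_deg_light_apex:
  "(\<Sum>(x, y, z)\<in>triples (light C). \<Sum>u\<in>nb (light C x) (N x) y \<inter> nb (light C x) (N x) z. real (deg u))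
    = (\<Sum>u\<in>V. real (deg u) * otriangles (light C u) (N u))"
proof -
  let ?L = "triples (light C)"
  define K where "K = (\<lambda>(x, y, z) u. light C x y u \<and> light C x z u \<and> light C y z u)"
  have fin: "finite ?L" by (rule finite_triples) (rule light_tri)
  have eq: "nb (light C x) (N x) y \<inter> nb (light C x) (N x) z = {u \<in> V. K (x, y, z) u}" if "light C x y z" for x y z
    using that EV by (auto simp: nb_def K_def light_def tri_def symi codeg_commute)
  have W: "card {t \<in> ?L. K t u} = otriangles (light C u) (N u)" if "u \<in> V" for u
  proof -
    have "{t \<in> ?L. K t u} = Sigma (N u) (\<lambda>x. Sigma (nb (light C u) (N u) x)
        (\<lambda>y. nb (light C u) (N u) x \<inter> nb (light C u) (N u) y))"
      by (auto simp: triples_def nb_def K_def light_def tri_def symi codeg_commute intro: EV)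
    then show ?thesis by (simp add: otriangles_def card_SigmaI)
  qed
  have "(\<Sum>(x, y, z)\<in>?L. \<Sum>u\<in>nb (light C x) (N x) y \<inter> nb (light C x) (N x) z. real (deg u))
      = (\<Sum>t\<in>?L. \<Sum>u\<in>{u \<in> V. K t u}. real (deg u))"
    by (intro sum.cong refl) (auto simp: triples_def eq)
  also have "\<dots> = (\<Sum>u\<in>V. \<Sum>t\<in>{t \<in> ?L. K t u}. real (deg u))"
    using fin finV by (rule sum.swap_restrict)
  also have "\<dots> = (\<Sum>u\<in>V. real (deg u) * otriangles (light C u) (N u))"
    using W by (intro sum.cong refl) (simp add: mult.commute)
  finally show ?thesis .
qed

section \<open>Links without paths on five vertices, for k = 3 and k = 4\<close>

text \<open>Bounding the triangle term by twice the arcs recovers the Erdos-Gallai bound of 3/2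
  edges per vertex.\<close>

lemma arcs_link_le_if_path_free_5:
  assumes "path_free E (N x) 5"
  shows "arcs E (N x) \<le> 3 * deg x"
  using arcs_le_if_path_free_5[of "N x" E] otriangles_le_if_path_free_5[of "N x" E] sym irr assms
  unfolding deg_def by fastforce

text \<open>Codegree at most one says that x y and x z lie in no triangle besides x y z.\<close>

definition private_base :: "nat \<Rightarrow> 'a \<Rightarrow> 'a \<Rightarrow> 'a \<Rightarrow> bool" where
  "private_base C x y z \<longleftrightarrow> heavy_base C x y z \<and> codeg x y \<le> 1 \<and> codeg x z \<le> 1"

lemma private_base_tri: "private_base C x y z \<Longrightarrow> tri x y z"
  by (simp add: private_base_def heavy_base_def)

text \<open>A vertex joined to \<open>x\<close> by an edge of codegree one of a private triangle
  pays for its single arc and meets no light edge of the link; the rest of the link is left to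
  \<open>arcs_le_if_path_free_5\<close>.\<close>

lemma link_count_private:
  assumes C: "1 \<le> C" and free: "path_free E (N x) 5"
  shows "12 * (arcs (private_base C x) (N x) + arcs (\<lambda>w z. private_base C w x z) (N x))
    + 6 * arcs (light C x) (N x) \<le> 12 * deg x + otriangles (light C x) (N x)"
proof -
  let ?P = "private_base C"
  define S1 where "S1 = {y \<in> N x. \<exists>z. ?P x y z}"
  define S2 where "S2 = {w \<in> N x. \<exists>z. ?P w x z}"
  have one: "z = z'" if "codeg x y \<le> 1" "tri x y z" "tri x y z'" for y z z'
  proof -
    have "{z, z'} \<subseteq> N x \<inter> N y" using that by (auto simp: tri_def)
    then have "card {z, z'} \<le> 1" using that(1) card_mono[of "N x \<inter> N y" "{z, z'}"] by (simp add: codeg_def)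
    then show ?thesis by (cases "z = z'") auto
  qed
  have Pd: "codeg a b \<le> 1" "codeg a c \<le> 1" "C < codeg b c" "tri a b c" if "?P a b c" for a b c
    using that by (auto simp: private_base_def heavy_base_def)
  have nb1: "card (nb R (N x) y) \<le> 1" if "\<And>z. R y z \<Longrightarrow> tri x y z \<and> codeg x y \<le> 1" for R y
  proof (cases "nb R (N x) y = {}")
    case False
    then obtain z where "R y z" by (auto simp: nb_def)
    then have "z' = z" if "R y z'" for z'
      using one[of y z' z] \<open>\<And>z. R y z \<Longrightarrow> tri x y z \<and> codeg x y \<le> 1\<close> that by blast
    then have "nb R (N x) y \<subseteq> {z}" by (auto simp: nb_def)
    then show ?thesis using card_mono[of "{z}" "nb R (N x) y"] by simp
  qed simp
  have "arcs (?P x) (N x) \<le> card (N x \<inter> S1)"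
  proof (rule arcs_le_card)
    show "card (nb (?P x) (N x) y) \<le> 1" for y
      by (rule nb1) (use Pd in blast)
  qed (use finV in \<open>auto simp: S1_def nb_def\<close>)
  moreover have "arcs (\<lambda>w z. ?P w x z) (N x) \<le> card (N x \<inter> S2)"
  proof (rule arcs_le_card)
    show "card (nb (\<lambda>w z. ?P w x z) (N x) y) \<le> 1" for y
      by (rule nb1) (use Pd triE codeg_commute in metis)
  qed (use finV in \<open>auto simp: S2_def nb_def\<close>)
  \<comment> \<open>For a vertex in both sets the same edge y z would be heavy, as a base, and of
    codegree at most one, as a leg.\<close>
  moreover have disj: "S1 \<inter> S2 = {}"
  proof -
    have False if "?P x y z" "?P y x z'" for y z z'
    proof -
      have "z = z'" using one[of y z z'] Pd[OF that(1)] Pd[OF that(2)] triE by blast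
      then show False using Pd[OF that(1)] Pd[OF that(2)] C by simp
    qed
    then show ?thesis by (auto simp: S1_def S2_def)
  qed
  moreover have sub: "S1 \<union> S2 \<subseteq> N x" by (auto simp: S1_def S2_def)
  moreover have "finite S1" "finite S2" using sub finite_subset[OF _ finite_N] by auto
  ultimately have a: "arcs (?P x) (N x) + arcs (\<lambda>w z. ?P w x z) (N x) \<le> card (S1 \<union> S2)"
    by (simp add: card_Un_disjoint Int_absorb1)
  define S where "S = S1 \<union> S2"
  have none: "\<not> light C x y w" if yS: "y \<in> S" for y w
  proof
    assume lt: "light C x y w"
    then have ltd: "tri x y w" "codeg x w \<le> C" "codeg y w \<le> C" by (auto simp: light_def)
    consider z where "?P x y z" | z where "?P y x z" using yS by (auto simp: S_def S1_def S2_def)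
    then show False
    proof cases
      case 1
      then have "w = z" using one[of y w z] Pd[OF 1] ltd by blast
      then show False using Pd[OF 1] ltd by simp
    next
      case 2
      then have "w = z" using one[of y w z] Pd[OF 2] ltd triE codeg_commute by metis
      then show False using Pd[OF 2] ltd by simp
    qed
  qed
  have Sx: "S \<subseteq> N x" using sub by (simp add: S_def)
  have sl: "light C x y w \<Longrightarrow> light C x w y" for y w using light_swap(1) by blast
  have "arcs (light C x) (N x) = arcs (light C x) (N x - S) + arcs (light C x) S"
    by (rule arcs_split_closed[OF finite_N Sx sl]) (simp_all add: none)
  then have "arcs (light C x) (N x) = arcs (light C x) (N x - S)" using none by (simp add: arcs_eq_0)
  moreover have "6 * arcs (light C x) (N x - S) \<le> 12 * card (N x - S) + otriangles (light C x) (N x - S)"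
    by (rule arcs_le_if_path_free_5[OF _ sl light_irr light_path_free[OF free]]) auto
  moreover have "otriangles (light C x) (N x - S) \<le> otriangles (light C x) (N x)"
    using otriangles_superadditive[of "N x" "N x - S" "{}" "light C x"] by simp
  moreover have "card (N x - S) + card S = deg x"
    unfolding deg_def using Sx by (metis card_Diff_subset card_mono finite_N finite_subset le_add_diff_inverse2)
  moreover have "12 * u + 6 * l \<le> 12 * d + t" if "l = l'" "6 * l' \<le> 12 * c + t'" "t' \<le> t" "c + s = d" "u \<le> s"
    for u l l' d t t' c s :: nat using that by simp
  ultimately show ?thesis using a unfolding S_def by blast
qed

lemma card_triples_le_private:
  assumes C: "1 \<le> C" and free: "\<And>x. x \<in> V \<Longrightarrow> path_free E (N x) 5"
  shows "real (card (triples tri)) \<le> 3 / 4 * (real (card V))\<^sup>2 + (9 + 18 * real C) * real (card V)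
    + 6 * real (card (triples (\<lambda>x y z. heavy_base C x y z \<and> 2 \<le> codeg x y)))"
proof -
  let ?P = "private_base C" let ?B = "\<lambda>x y z. heavy_base C x y z \<and> 2 \<le> codeg x y"
  let ?B' = "\<lambda>x y z. heavy_base C x y z \<and> 2 \<le> codeg x z"
  define n where "n = real (card V)"
  define p where "p = real (card (triples ?P))"
  define q where "q = real (card (triples (light C)))"
  define a where "a v = real (arcs (?P v) (N v) + arcs (\<lambda>x z. ?P x v z) (N v))" for v
  \<comment> \<open>\<open>l v\<close> is the number of edges of the light link of \<open>v\<close>,
    and \<open>b v\<close> half the number of its triangles, matching the weight 1/2 of common
    neighbours.\<close>
  define l where "l v = real (arcs (light C v) (N v)) / 2" for v
  define b where "b v = real (otriangles (light C v) (N v)) / 12" for v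
  define d where "d v = real (deg v)" for v
  have t3: "card (triples tri) \<le> 3 * card V * card V"
    using card_triples_le_arcs[of 3] arcs_link_le_if_path_free_5 free by blast
  have fint: "finite (triples tri)" by (rule finite_triples)
  have sub: "p \<le> 3 * n\<^sup>2" "q \<le> 3 * n\<^sup>2"
  proof -
    have "card (triples ?P) \<le> card (triples tri)" "card (triples (light C)) \<le> card (triples tri)"
      using fint private_base_tri light_tri by (auto intro!: card_mono simp: triples_def)
    then have "p \<le> real (3 * card V * card V)" "q \<le> real (3 * card V * card V)"
      unfolding p_def q_def of_nat_le_iff using t3 by linarith+
    then show "p \<le> 3 * n\<^sup>2" "q \<le> 3 * n\<^sup>2"
      by (simp_all add: n_def power2_eq_square)
  qed
  have suma: "(\<Sum>v\<in>V. a v) = 2 * p"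
    unfolding a_def p_def using card_triples_twice[of ?P, OF private_base_tri] by simp
  have suml: "(\<Sum>v\<in>V. l v) = q / 2"
    unfolding l_def q_def by (simp add: card_triples[of "light C", OF light_tri] flip: sum_divide_distrib)
  have pair: "(\<Sum>v\<in>V. d v * a v) \<le> p * (n + 1)"
  proof -
    have "(\<Sum>v\<in>V. d v * a v) = (\<Sum>(x, y, z)\<in>triples ?P. real (deg x + deg y))"
      unfolding a_def d_def using sum_deg_pair[of ?P, OF private_base_tri] by simp
    also have "\<dots> \<le> (\<Sum>(x, y, z)\<in>triples ?P. n + 1)"
    proof (rule sum_mono, clarify)
      fix x y z assume "(x, y, z) \<in> triples ?P"
      then have "codeg x y \<le> 1" by (simp add: triples_def private_base_def)
      then have "deg x + deg y \<le> card V + 1" using deg_pair_le[of x y] by linarith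
      then show "real (deg x + deg y) \<le> n + 1" unfolding n_def by linarith
    qed
    finally show ?thesis by (simp add: p_def case_prod_unfold)
  qed
  have light: "(\<Sum>v\<in>V. d v * (l v + b v)) \<le> q * (n + 6 * real C) / 6"
  proof -
    define U where "U x y z = nb (light C x) (N x) y \<inter> nb (light C x) (N x) z" for x y z
    have "(\<Sum>v\<in>V. 12 * (d v * (l v + b v)))
        = 2 * (3 * (\<Sum>v\<in>V. d v * arcs (light C v) (N v))) + (\<Sum>v\<in>V. d v * otriangles (light C v) (N v))"
      unfolding l_def b_def by (simp add: sum_distrib_left sum.distrib algebra_simps)
    also have "\<dots> = (\<Sum>(x, y, z)\<in>triples (light C). real (2 * (deg x + deg y + deg z) + (\<Sum>u\<in>U x y z. deg u)))"
      unfolding d_def sum_deg_light[symmetric] sum_deg_light_apex[symmetric] U_def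
      by (simp add: case_prod_unfold sum.distrib sum_distrib_left)
    also have "\<dots> \<le> (\<Sum>(x, y, z)\<in>triples (light C). 2 * n + 12 * real C)"
    proof (rule sum_mono, clarify)
      fix x y z assume "(x, y, z) \<in> triples (light C)"
      then have lt: "light C x y z" by (simp add: triples_def)
      then have ld: "E x y" "E x z" "x \<in> V" "codeg x y \<le> C" "codeg x z \<le> C" "codeg y z \<le> C"
        using EV by (auto simp: light_def tri_def)
      have fU: "finite (U x y z)" by (simp add: U_def)
      \<comment> \<open>y z is an edge of the light link of \<open>x\<close>, which has no path on
        five vertices.\<close>
      have cU: "card (U x y z) \<le> 2"
        unfolding U_def
        by (rule card_common_nb_le_2)
          (use lt ld light_irr light_path_free[OF free] in \<open>auto simp: light_swap(1)[of C x]\<close>)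
      have "codeg x u + codeg y u + codeg z u \<le> 3 * C" if "u \<in> U x y z" for u
        using that lt by (auto simp: U_def nb_def light_def codeg_commute)
      then have "(\<Sum>u\<in>U x y z. codeg x u + codeg y u + codeg z u) \<le> card (U x y z) * (3 * C)"
        using sum_bounded_above[of "U x y z" "\<lambda>u. codeg x u + codeg y u + codeg z u" "3 * C"] by simp
      also have "\<dots> \<le> 2 * (3 * C)" using cU by (rule mult_le_mono1)
      finally have s: "(\<Sum>u\<in>U x y z. codeg x u + codeg y u + codeg z u) \<le> 6 * C" by simp
      have "2 * (deg x + deg y + deg z) + (\<Sum>u\<in>U x y z. deg u) \<le> 2 * card V
          + 2 * (codeg x y + codeg x z + codeg y z) + (\<Sum>u\<in>U x y z. codeg x u + codeg y u + codeg z u)"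
        by (rule deg_triangle_le[OF fU cU])
      also have "\<dots> \<le> 2 * card V + 2 * (C + C + C) + 6 * C"
        using ld(4-) s by (intro add_mono mult_le_mono order_refl)
      finally have "2 * (deg x + deg y + deg z) + (\<Sum>u\<in>U x y z. deg u) \<le> 2 * card V + 12 * C" by simp
      then show "real (2 * (deg x + deg y + deg z) + (\<Sum>u\<in>U x y z. deg u)) \<le> 2 * n + 12 * real C"
        unfolding n_def by linarith
    qed
    also have "\<dots> = q * (2 * n + 12 * real C)" by (simp add: q_def case_prod_unfold)
    finally have "12 * (\<Sum>v\<in>V. d v * (l v + b v)) \<le> q * (2 * n + 12 * real C)"
      by (simp add: sum_distrib_left)
    then show ?thesis by (simp add: algebra_simps)
  qed
  \<comment> \<open>The weights make \<open>a v / 2 + 2 * l v / 3\<close> sum over \<open>V\<close>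
    to \<open>(q + 3 * p) / 3\<close>, and \<open>q + 3 * p\<close> bounds the number of ordered
    triangles up to the exceptional ones.\<close>
  have point: "n * (a v / 2 + 2 * l v / 3) - d v * (a v / 2 + l v + b v) \<le> n\<^sup>2 / 8" if "v \<in> V" for v
  proof (rule quadratic_bound_one)
    show "a v + l v \<le> d v + b v"
      using link_count_private[OF C free[OF that], THEN of_nat_mono[where 'a = real]]
      by (simp add: a_def l_def d_def b_def)
    have "otriangles (light C v) (N v) \<le> 2 * arcs (light C v) (N v)"
      by (rule otriangles_le_if_path_free_5)
        (use light_irr light_path_free[OF free[OF that]] in \<open>auto simp: light_swap(1)[of C v]\<close>)
    then show "3 * b v \<le> l v" unfolding l_def b_def by simp
  qed (simp_all add: a_def b_def)
  have "(\<Sum>v\<in>V. n * (a v / 2 + 2 * l v / 3) - d v * (a v / 2 + l v + b v)) \<le> (\<Sum>v\<in>V. n\<^sup>2 / 8)"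
    by (rule sum_mono) (rule point)
  also have "\<dots> = n ^ 3 / 8" by (simp add: n_def power3_eq_cube power2_eq_square)
  also have "(\<Sum>v\<in>V. n * (a v / 2 + 2 * l v / 3) - d v * (a v / 2 + l v + b v))
      = (\<Sum>v\<in>V. n / 2 * a v + 2 * n / 3 * l v - 1 / 2 * (d v * a v) - d v * (l v + b v))"
    by (intro sum.cong refl) (simp add: algebra_simps)
  also have "\<dots> = n / 2 * (\<Sum>v\<in>V. a v) + 2 * n / 3 * (\<Sum>v\<in>V. l v)
      - 1 / 2 * (\<Sum>v\<in>V. d v * a v) - (\<Sum>v\<in>V. d v * (l v + b v))"
    by (simp only: sum_subtractf sum.distrib sum_distrib_left)
  finally have "n / 2 * (2 * p) + 2 * n / 3 * (q / 2) - 1 / 2 * (\<Sum>v\<in>V. d v * a v)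
      - (\<Sum>v\<in>V. d v * (l v + b v)) \<le> n ^ 3 / 8"
    by (simp only: suma suml)
  moreover have "n * (p + q / 3) = n / 2 * (2 * p) + 2 * n / 3 * (q / 2)"
    by (simp add: algebra_simps)
  \<comment> \<open>Up to lower order the degree sums give back half of the left side,
    \<open>n * (p / 2 + q / 6)\<close>.\<close>
  ultimately have "n * (p + q / 3) \<le> n ^ 3 / 8 + p * (n + 1) / 2 + q * (n + 6 * real C) / 6"
    using pair light by linarith
  then have main: "n * (q + 3 * p) \<le> 3 / 4 * n ^ 3 + 3 * p + 6 * real C * q"
    by (simp add: field_simps)
  have "p * 3 \<le> 9 * n\<^sup>2" using sub by simp
  moreover have "6 * real C * q \<le> 6 * real C * (3 * n\<^sup>2)" using sub by (intro mult_left_mono) auto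
  ultimately have main': "n * (q + 3 * p) \<le> n * (3 / 4 * n\<^sup>2 + (9 + 18 * real C) * n)"
    using main by (simp add: power2_eq_square power3_eq_cube algebra_simps)
  have qp: "q + 3 * p \<le> 3 / 4 * n\<^sup>2 + (9 + 18 * real C) * n"
  proof (cases "n = 0")
    case True
    then show ?thesis using sub by (simp add: p_def q_def)
  next
    case False
    then have "n > 0" by (simp add: n_def)
    then show ?thesis using main' by simp
  qed
  have "card (triples (heavy_base C)) \<le> card (triples ?P) + 2 * card (triples ?B)"
  proof -
    have fin: "finite (triples ?P)" "finite (triples ?B)" "finite (triples ?B')"
      by (rule finite_triples; simp add: private_base_def heavy_base_def)+
    have "triples (heavy_base C) \<subseteq> triples ?P \<union> triples ?B \<union> triples ?B'"
      by (auto simp: triples_def private_base_def)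
    then have "card (triples (heavy_base C)) \<le> card (triples ?P \<union> triples ?B \<union> triples ?B')"
      using fin by (intro card_mono) auto
    also have "\<dots> \<le> card (triples ?P) + card (triples ?B) + card (triples ?B')"
      by (intro order_trans[OF card_Un_le] add_mono order_refl)
    also have "card (triples ?B') = card (triples ?B)"
    proof -
      have "heavy_base C x y z \<longleftrightarrow> heavy_base C x z y" for x y z
        by (auto simp: heavy_base_def tri_def symi codeg_commute)
      then have "(\<lambda>x z y. heavy_base C x y z \<and> 2 \<le> codeg x z) = ?B" by (intro ext) blast
      then show ?thesis using card_triples_swap'[of ?B'] by (simp only:)
    qed
    finally show ?thesis by simp
  qed
  then have "card (triples tri) \<le> card (triples (light C)) + 3 * card (triples ?P) + 6 * card (triples ?B)"
    using card_triples_le_light_heavy[of C] by linarith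
  then have "real (card (triples tri)) \<le> q + 3 * p + 6 * real (card (triples ?B))"
    unfolding p_def q_def by linarith
  then show ?thesis using qp unfolding n_def by linarith
qed

text \<open>In the link of \<open>y\<close> the vertex \<open>z\<close> of a heavy edge has degree
  above four, hence at most two non-leaf neighbours: at most two exceptional apexes per heavy pair
  and leg.\<close>

theorem card_triples_le_if_link_path_free_5:
  assumes free: "\<And>x. x \<in> V \<Longrightarrow> path_free E (N x) 5" and C: "4 \<le> C"
  shows "real (card (triples tri)) \<le> 3 / 4 * (real (card V))\<^sup>2 + (9 + 18 * real C) * real (card V)
    + 36 * (real (card V))\<^sup>2 / real C"
proof -
  let ?B = "\<lambda>x y z. heavy_base C x y z \<and> 2 \<le> codeg x y"
  have "card (triples ?B) \<le> 2 * card (heavy_pairs C)"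
  proof (rule card_heavy_base_le)
    fix y z assume yz: "E y z" "C < codeg y z"
    have "{x. tri x y z \<and> 2 \<le> codeg x y} = {x \<in> nb E (N y) z. 2 \<le> card (nb E (N y) x)}"
      using yz by (auto simp: nb_def[of E "N y" z] card_nb_link tri_def symi codeg_commute)
    also have "card \<dots> \<le> 2"
      by (rule card_nonleaf_nb_if_path_free_5)
        (use irr free yz EV C in \<open>auto simp: card_nb_link symi\<close>)
    finally show "card {x. tri x y z \<and> 2 \<le> codeg x y} \<le> 2" .
  qed
  moreover have "Suc C * card (heavy_pairs C) \<le> 3 * card V * card V"
    using card_heavy_pairs_le[of 3] arcs_link_le_if_path_free_5 free by blast
  moreover have "C * card (heavy_pairs C) \<le> Suc C * card (heavy_pairs C)" by simp
  ultimately have "C * card (triples ?B) \<le> 6 * card V * card V"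
    using mult_le_mono2[of "card (triples ?B)" "2 * card (heavy_pairs C)" C] by linarith
  then have "real (C * card (triples ?B)) \<le> real (6 * card V * card V)"
    by (simp only: of_nat_le_iff)
  then have "real C * real (card (triples ?B)) \<le> 6 * (real (card V))\<^sup>2"
    by (simp add: power2_eq_square)
  then have "6 * real (card (triples ?B)) \<le> 36 * (real (card V))\<^sup>2 / real C"
    using C by (simp add: field_simps)
  then show ?thesis
    using card_triples_le_private[of C] C free by simp
qed

text \<open>Threshold 3 makes all neighbours of \<open>z\<close> leaves in the link of
  \<open>y\<close>, so nothing is exceptional; \<open>63\<close> is
  \<open>9 + 18 * 3\<close>.\<close>

theorem card_triples_le_if_link_path_free_4:
  assumes free: "\<And>x. x \<in> V \<Longrightarrow> path_free E (N x) 4"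
  shows "real (card (triples tri)) \<le> 3 / 4 * (real (card V))\<^sup>2 + 63 * real (card V)"
proof -
  let ?B = "\<lambda>x y z. heavy_base 3 x y z \<and> 2 \<le> codeg x y"
  have "card (triples ?B) \<le> 0 * card (heavy_pairs 3)"
  proof (rule card_heavy_base_le)
    fix y z assume yz: "E y z" "3 < codeg y z"
    have "codeg x y \<le> 1" if "tri x y z" for x
    proof -
      have "x \<in> nb E (N y) z" using that by (simp add: tri_def nb_def[of E "N y"] symi)
      then have "card (nb E (N y) x) \<le> 1"
        by (intro card_nb_le_1_if_path_free_4[of "N y" E z])
          (use irr free[of y] yz EV in \<open>auto simp: card_nb_link symi\<close>)
      then show ?thesis by (simp add: card_nb_link codeg_commute)
    qed
    then have "{x. tri x y z \<and> 2 \<le> codeg x y} = {}" by force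
    then show "card {x. tri x y z \<and> 2 \<le> codeg x y} \<le> 0" by (simp only: card.empty)
  qed
  moreover have "path_free E (N x) 5" if "x \<in> V" for x
    using free[OF that] unfolding path_free_def by force
  ultimately show ?thesis using card_triples_le_private[of 3] by simp
qed

end

section \<open>Links without paths on six vertices, for k = 5\<close>

context fin_graph
begin

lemma arcs_link_le_if_path_free_6:
  assumes "path_free E (N x) 6"
  shows "arcs E (N x) \<le> 4 * deg x"
  unfolding deg_def by (rule arcs_le_if_path_free_6[OF finite_N sym irr assms])

lemma legs_eq:
  assumes "E y z"
  shows "{x. tri x y z \<and> 3 \<le> codeg x y} = {x \<in> nb E (N y) z. 3 \<le> card (nb E (N y) x)}"
  using assms by (auto simp: nb_def[of E "N y" z] card_nb_link tri_def symi codeg_commute)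

text \<open>A heavy edge $yz$ has at most four common neighbours \<open>x\<close> that are not mild. For the others with
  \<open>3 \<le> codeg x y\<close> the link of \<open>y\<close> looks near \<open>z\<close> like a spider with body \<open>z\<close>.\<close>

definition mild :: "'a \<Rightarrow> 'a \<Rightarrow> 'a \<Rightarrow> bool" where
  "mild x y z \<longleftrightarrow> codeg x y \<le> 2 \<or> 5 \<le> card {w. tri w y z \<and> 3 \<le> codeg w y}"

text \<open>The link of \<open>y\<close> near \<open>z\<close> is handled by
  \<open>nb_legs_if_path_free_6\<close>. The outcome means that x y w is the only triangle on the
  edge y w.\<close>

lemma common_nb_if_mild:
  assumes free: "path_free E (N y) 6" and t: "tri x y z" and m: "mild x y z" "3 \<le> codeg x y"
    and w: "E y w" "E x w" "w \<noteq> z"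
  shows "nb E (N y) w = {x}"
proof (rule nb_legs_if_path_free_6[of "N y" E z x w, OF finite_N sym irr free])
  show "z \<in> N y" using t by (simp add: tri_def)
  have "E y z" using t by (simp add: tri_def)
  then show "5 \<le> card {x \<in> nb E (N y) z. 3 \<le> card (nb E (N y) x)}"
    using m by (simp add: mild_def flip: legs_eq)
  show "x \<in> nb E (N y) z" using t by (simp add: nb_def[of E "N y"] tri_def symi)
  show "3 \<le> card (nb E (N y) x)" using m by (simp add: card_nb_link codeg_commute)
  show "w \<in> nb E (N y) x" using w by (simp add: nb_def[of E "N y"])
qed (assumption | rule w)+

definition mild_base :: "nat \<Rightarrow> 'a \<Rightarrow> 'a \<Rightarrow> 'a \<Rightarrow> bool" where
  "mild_base C x y z \<longleftrightarrow> heavy_base C x y z \<and> codeg x y \<le> C \<and> codeg x z \<le> C \<and> mild x y z \<and> mild x z y"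

lemma mild_base_tri: "mild_base C x y z \<Longrightarrow> tri x y z"
  by (simp add: mild_base_def heavy_base_def)

lemma mild_base_swap: "mild_base C x y z \<Longrightarrow> mild_base C x z y"
  by (auto simp: mild_base_def heavy_base_def tri_def symi codeg_commute)

text \<open>Edges opposite \<open>x\<close> in mild triangles with apex \<open>x\<close> are the
  marked ones, which \<open>arcs_marked_le\<close> counts twice. Triangles with \<open>x\<close> on
  the base enter \<open>arcs E (N x)\<close> in both directions, so both kinds get weight
  two.\<close>

lemma link_count_mild:
  assumes C: "1 \<le> C" and free: "\<And>x. x \<in> V \<Longrightarrow> path_free E (N x) 6" and x: "x \<in> V"
  shows "2 * arcs (mild_base C x) (N x) + 2 * arcs (\<lambda>w z. mild_base C w x z) (N x)
    + arcs (light C x) (N x) \<le> 4 * deg x"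
proof -
  let ?M = "mild_base C"
  have Md: "codeg a b \<le> C" "codeg a c \<le> C" "C < codeg b c" "tri a b c" if "?M a b c" for a b c
    using that by (auto simp: mild_base_def heavy_base_def)
  have "arcs E (N x) + arcs (?M x) (N x) \<le> 4 * card (N x)"
  proof (rule arcs_marked_le[OF finite_N sym irr])
    show "?M x z y" if "?M x y z" for y z using that by (rule mild_base_swap)
    show "E y z" if "?M x y z" for y z using Md(4)[OF that] by (simp add: tri_def)
    show "path_free E (N x) 6" using free x by blast
    fix y z assume M: "?M x y z"
    note Mx = Md[OF M]
    show "card (nb E (N x) y) \<le> 2 \<or>
      (card (nb (?M x) (N x) y) \<le> 1 \<and> (\<forall>u\<in>nb E (N x) y. \<forall>w\<in>nb E (N x) y. \<not> E u w))"
    proof (cases "codeg x y \<le> 2")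
      case True
      then show ?thesis by (simp add: card_nb_link)
    next
      case False
      have yV: "y \<in> V" using Mx(4) EV by (auto simp: tri_def)
      have m: "mild x y z" using M by (simp add: mild_base_def)
      \<comment> \<open>Any common neighbour \<open>w\<close> other than \<open>z\<close> makes y w
        an edge of codegree one, hence not heavy: \<open>y\<close> has no second marked edge, and no
        two of its neighbours in the link are adjacent.\<close>
      have only: "nb E (N y) w = {x}" if "E y w" "E x w" "w \<noteq> z" for w
        using common_nb_if_mild[OF free[OF yV] Mx(4) m] False that by simp
      have "nb (?M x) (N x) y \<subseteq> {z}"
      proof
        fix w assume "w \<in> nb (?M x) (N x) y"
        then have Mw: "?M x y w" by (simp add: nb_def)
        show "w \<in> {z}"
        proof (rule ccontr)
          assume "w \<notin> {z}"
          then have "nb E (N y) w = {x}" using only Md(4)[OF Mw] by (simp add: tri_def)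
          then have "codeg y w = 1" using card_nb_link[of y w] by simp
          then show False using Md(3)[OF Mw] C by simp
        qed
      qed
      then have "card (nb (?M x) (N x) y) \<le> 1" using card_mono[of "{z}"] by force
      moreover have "\<not> E u w" if uw: "E x u" "E y u" "E x w" "E y w" for u w
      proof
        assume "E u w"
        have False if "E x a" "E y a" "E x b" "E y b" "E a b" "a \<noteq> z" for a b
        proof -
          have "b \<in> nb E (N y) a" using that by (simp add: nb_def[of E "N y"])
          then have "b = x" using only[of a] that by simp
          then show False using that irr by blast
        qed
        from this[of u w] this[of w u] show False
          using uw \<open>E u w\<close> sym irr by blast
      qed
      ultimately show ?thesis by (simp add: nb_def[of E "N x"])
    qed
  qed
  moreover have "arcs (?M x) (N x) + arcs (light C x) (N x) + arcs (\<lambda>w z. ?M w x z) (N x)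
      + arcs (\<lambda>z w. ?M w x z) (N x) \<le> arcs E (N x)"
  proof -
    let ?n = "\<lambda>Q y. nb Q (N x) y"
    have "card (?n (?M x) y) + card (?n (light C x) y) + card (?n (\<lambda>w z. ?M w x z) y)
      + card (?n (\<lambda>z w. ?M w x z) y) \<le> card (?n E y)" if "E x y" for y
    proof -
      let ?A = "?n (?M x) y" and ?B = "?n (light C x) y" and ?D = "?n (\<lambda>w z. ?M w x z) y"
        and ?F = "?n (\<lambda>z w. ?M w x z) y"
      have cB: "codeg x y \<le> C \<and> codeg x z \<le> C \<and> codeg y z \<le> C" if "z \<in> ?B" for z
        using that by (simp add: nb_def light_def)
      have cA: "codeg x y \<le> C \<and> codeg x z \<le> C \<and> C < codeg y z" if "z \<in> ?A" for z
        using that Md[of x y z] by (simp add: nb_def)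
      have cD: "C < codeg x z \<and> codeg x y \<le> C" if "z \<in> ?D" for z
        using that Md[of y x z] by (simp add: nb_def codeg_commute)
      have cF: "C < codeg x y" if "z \<in> ?F" for z
        using that Md[of z x y] by (simp add: nb_def)
      \<comment> \<open>The sets differ in which edge of the triangle is heavy: y z, none, x z, x
        y.\<close>
      have dis: "?A \<inter> ?B = {}" "(?A \<union> ?B) \<inter> ?D = {}" "(?A \<union> ?B \<union> ?D) \<inter> ?F = {}"
        using cA cB cD cF by (fastforce dest: leD)+
      have sub: "?A \<union> ?B \<union> ?D \<union> ?F \<subseteq> ?n E y"
      proof
        fix z assume "z \<in> ?A \<union> ?B \<union> ?D \<union> ?F"
        then have "E x z \<and> (tri x y z \<or> tri y x z \<or> tri z x y)"
          using Md(4)[of x y z] Md(4)[of y x z] Md(4)[of z x y] by (auto simp: nb_def light_def)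
        then show "z \<in> ?n E y" by (auto simp: nb_def[of E "N x"] tri_def symi)
      qed
      have "card ?A + card ?B + card ?D + card ?F = card (?A \<union> ?B \<union> ?D \<union> ?F)"
        using dis finV by (simp add: card_Un_disjoint)
      also have "\<dots> \<le> card (?n E y)" using sub by (intro card_mono) auto
      finally show ?thesis .
    qed
    then show ?thesis unfolding arcs_def sum.distrib[symmetric] by (intro sum_mono) simp
  qed
  moreover have "arcs (\<lambda>z w. ?M w x z) (N x) = arcs (\<lambda>w z. ?M w x z) (N x)"
    by (rule arcs_converse) simp
  ultimately show ?thesis unfolding deg_def by simp
qed

text \<open>A single \<open>codeg x y\<close> may be linear in \<open>card V\<close>, but for a
  fixed heavy pair the sum over all neighbours \<open>x\<close> of \<open>y\<close> is the number of
  arcs of one link.\<close>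

lemma sum_codeg_heavy_le:
  assumes free: "\<And>x. x \<in> V \<Longrightarrow> path_free E (N x) 6" and Q: "\<And>x y z. Q x y z \<Longrightarrow> heavy_base C x y z"
  shows "(\<Sum>(x, y, z)\<in>triples Q. codeg x y) \<le> card (heavy_pairs C) * (4 * card V)"
proof -
  let ?S = "Sigma (heavy_pairs C) (\<lambda>p. N (fst p))"
  have fS: "finite ?S" by (rule finite_SigmaI) (simp_all add: finite_heavy_pairs)
  have "(\<Sum>(x, y, z)\<in>triples Q. codeg x y) \<le> (\<Sum>(p, x)\<in>?S. codeg (fst p) x)"
  proof (rule sum_le_included[of _ _ _ "\<lambda>(p, x). (x, fst p, snd p)"])
    show "finite (triples Q)" using Q by (intro finite_triples) (auto simp: heavy_base_def)
    show "\<forall>t\<in>triples Q. \<exists>s\<in>?S. (case s of (p, x) \<Rightarrow> (x, fst p, snd p)) = t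
        \<and> (case t of (x, y, z) \<Rightarrow> codeg x y) \<le> (case s of (p, x) \<Rightarrow> codeg (fst p) x)"
    proof (clarify)
      fix x y z assume "(x, y, z) \<in> triples Q"
      then have "heavy_base C x y z" using Q by (simp add: triples_def)
      then have "((y, z), x) \<in> ?S" by (simp add: heavy_base_def heavy_pairs_def tri_def symi)
      then show "\<exists>s\<in>?S. (case s of (p, x) \<Rightarrow> (x, fst p, snd p)) = (x, y, z)
        \<and> codeg x y \<le> (case s of (p, x) \<Rightarrow> codeg (fst p) x)"
        by (intro bexI[of _ "((y, z), x)"]) (simp_all add: codeg_commute)
    qed
  qed (use fS in auto)
  also have "\<dots> = (\<Sum>p\<in>heavy_pairs C. arcs E (N (fst p)))"
    unfolding arcs_link by (subst sum.Sigma) (simp_all add: finite_heavy_pairs)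
  also have "\<dots> \<le> (\<Sum>p\<in>heavy_pairs C. 4 * card V)"
  proof (rule sum_mono)
    fix p assume "p \<in> heavy_pairs C"
    then have "fst p \<in> V" using EV by (auto simp: heavy_pairs_def)
    then show "arcs E (N (fst p)) \<le> 4 * card V"
      using arcs_link_le_if_path_free_6 free deg_le by (meson le_trans mult_le_mono2)
  qed
  finally show ?thesis by simp
qed

text \<open>\<open>208 = 2 * (100 + 4)\<close>: for a heavy pair at most 100 apexes are joined to
  \<open>y\<close> by a heavy edge, as \<open>y\<close> lies on no more of these, and at most four
  are not mild; the same holds at \<open>z\<close>.\<close>

lemma card_heavy_base_le_mild:
  assumes free: "\<And>x. x \<in> V \<Longrightarrow> path_free E (N x) 6" and C: "card V < 25 * Suc C"
  shows "card (triples (heavy_base C)) \<le> card (triples (mild_base C)) + 208 * card (heavy_pairs C)"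
proof -
  let ?h = "heavy_base C"
  let ?B1 = "\<lambda>x y z. ?h x y z \<and> C < codeg x y" let ?B1' = "\<lambda>x y z. ?h x y z \<and> C < codeg x z"
  let ?B2 = "\<lambda>x y z. ?h x y z \<and> \<not> mild x y z" let ?B2' = "\<lambda>x y z. ?h x y z \<and> \<not> mild x z y"
  have fin: "finite (triples (mild_base C))" "finite (triples ?B1)" "finite (triples ?B1')"
    "finite (triples ?B2)" "finite (triples ?B2')"
    by (rule finite_triples; simp add: mild_base_def heavy_base_def)+
  have "triples ?h \<subseteq> triples (mild_base C) \<union> triples ?B1 \<union> triples ?B1' \<union> triples ?B2 \<union> triples ?B2'"
    by (auto simp: triples_def mild_base_def)
  then have "card (triples ?h) \<le> card (triples (mild_base C) \<union> triples ?B1 \<union> triples ?B1' \<union> triples ?B2 \<union> triples ?B2')"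
    using fin by (intro card_mono) auto
  also have "\<dots> \<le> card (triples (mild_base C)) + card (triples ?B1) + card (triples ?B1')
      + card (triples ?B2) + card (triples ?B2')"
    by (intro order_trans[OF card_Un_le] add_mono order_refl)
  also have "card (triples ?B1') = card (triples ?B1)"
  proof -
    have "(\<lambda>x z y. ?B1' x y z) = ?B1"
      by (intro ext) (auto simp: heavy_base_def tri_def symi codeg_commute)
    then show ?thesis using card_triples_swap'[of ?B1'] by (simp only:)
  qed
  also have "card (triples ?B2') = card (triples ?B2)"
  proof -
    have "(\<lambda>x z y. ?B2' x y z) = ?B2"
      by (intro ext) (auto simp: heavy_base_def tri_def symi codeg_commute)
    then show ?thesis using card_triples_swap'[of ?B2'] by (simp only:)
  qed
  also have "card (triples ?B1) \<le> 100 * card (heavy_pairs C)"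
  proof (rule card_heavy_base_le)
    fix y z assume yz: "E y z"
    let ?H = "{x \<in> N y. C < codeg y x}"
    have "card {x. tri x y z \<and> C < codeg x y} \<le> card ?H"
      by (rule card_mono[OF finite_subset[of _ "N y"]]) (auto simp: tri_def symi codeg_commute)
    also have "card ?H \<le> 100"
    proof -
      have "Suc C * card ?H \<le> arcs E (N y)" by (rule card_heavy_nbs_le)
      also have "\<dots> \<le> 4 * card V"
        using arcs_link_le_if_path_free_6 free[of y] deg_le[of y] yz EV by (meson le_trans mult_le_mono2)
      also have "\<dots> < Suc C * 101" using C by simp
      finally have "card ?H < 101" by (simp only: mult_less_cancel1)
      then show ?thesis by linarith
    qed
    finally show "card {x. tri x y z \<and> C < codeg x y} \<le> 100" .
  qed
  also have "card (triples ?B2) \<le> 4 * card (heavy_pairs C)"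
  proof (rule card_heavy_base_le)
    fix y z assume yz: "E y z"
    let ?W = "{w. tri w y z \<and> 3 \<le> codeg w y}"
    have fW: "finite ?W" unfolding legs_eq[OF yz] by (rule finite_subset[of _ "nb E (N y) z"]) auto
    show "card {x. tri x y z \<and> \<not> mild x y z} \<le> 4"
    proof (cases "5 \<le> card ?W")
      case True
      then have "{x. tri x y z \<and> \<not> mild x y z} = {}" by (simp add: mild_def)
      then show ?thesis by (simp only: card.empty)
    next
      case False
      have "card {x. tri x y z \<and> \<not> mild x y z} \<le> card ?W"
        by (rule card_mono[OF fW]) (auto simp: mild_def)
      then show ?thesis using False by linarith
    qed
  qed
  finally show ?thesis by simp
qed

text \<open>In \<open>63600 = 1200 + 3 * 208 * 100\<close> the first summand stems from the
  codegrees in the pair inequality, the second from exceptional triangles at the at most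
  \<open>100 * card V\<close> heavy pairs.\<close>

theorem card_triples_le_if_link_path_free_6:
  assumes free: "\<And>x. x \<in> V \<Longrightarrow> path_free E (N x) 6"
  shows "real (card (triples tri)) \<le> 3 / 2 * (real (card V))\<^sup>2 + 63600 * real (card V)"
proof (cases "card V < 25")
  \<comment> \<open>Below 25 vertices the threshold would be zero, while
    \<open>link_count_mild\<close> asks for \<open>1 \<le> C\<close>.\<close>
  case True
  have "card (triples tri) \<le> 4 * card V * card V"
    using card_triples_le_arcs[of 4] arcs_link_le_if_path_free_6 free by blast
  also have "\<dots> \<le> 4 * card V * 25" using True by (intro mult_le_mono2) simp
  finally have "card (triples tri) \<le> 100 * card V" by simp
  then have "real (card (triples tri)) \<le> 100 * real (card V)"
    by (metis of_nat_le_iff of_nat_mult of_nat_numeral)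
  moreover have "0 \<le> 3 / 2 * (real (card V))\<^sup>2" by simp
  ultimately show ?thesis by linarith
next
  case False
  define C where "C = card V div 25"
  have C1: "1 \<le> C" using False by (simp add: C_def)
  have C: "25 * C \<le> card V" "card V < 25 * Suc C" unfolding C_def by simp_all
  let ?M = "mild_base C"
  define n where "n = real (card V)"
  define p where "p = real (card (triples ?M))"
  define q where "q = real (card (triples (light C)))"
  define h where "h = real (card (heavy_pairs C))"
  define a where "a v = real (arcs (?M v) (N v) + arcs (\<lambda>x z. ?M x v z) (N v)) / 2" for v
  define l where "l v = real (arcs (light C v) (N v)) / 2" for v
  define d where "d v = real (deg v)" for v
  have n0: "n > 0" using False by (simp add: n_def)
  have hle: "h \<le> 100 * n"
  proof -
    have "Suc C * card (heavy_pairs C) \<le> 4 * card V * card V"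
      using card_heavy_pairs_le[of 4] arcs_link_le_if_path_free_6 free by blast
    then have "25 * (Suc C * card (heavy_pairs C)) \<le> 25 * (4 * card V * card V)"
      by (rule mult_le_mono2)
    moreover have "card V * card (heavy_pairs C) \<le> 25 * Suc C * card (heavy_pairs C)"
      using C by (intro mult_le_mono1) simp
    ultimately have "card V * card (heavy_pairs C) \<le> card V * (100 * card V)"
      by (simp only: mult.assoc)
    then have "card (heavy_pairs C) \<le> 100 * card V" using False by simp
    then show ?thesis unfolding h_def n_def by (metis of_nat_le_iff of_nat_mult of_nat_numeral)
  qed
  have suma: "(\<Sum>v\<in>V. a v) = p"
    unfolding a_def p_def using card_triples_twice[of ?M, OF mild_base_tri[of C]] by (simp flip: sum_divide_distrib)
  have suml: "(\<Sum>v\<in>V. l v) = q / 2"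
    unfolding l_def q_def by (simp add: card_triples[of "light C", OF light_tri] flip: sum_divide_distrib)
  have pair: "2 * (\<Sum>v\<in>V. d v * a v) \<le> p * n + 400 * n\<^sup>2"
  proof -
    have "2 * (\<Sum>v\<in>V. d v * a v) = (\<Sum>(x, y, z)\<in>triples ?M. real (deg x + deg y))"
      unfolding a_def d_def using sum_deg_pair[of ?M, OF mild_base_tri[of C]] by (simp add: sum_distrib_left)
    also have "\<dots> \<le> (\<Sum>(x, y, z)\<in>triples ?M. n + real (codeg x y))"
    proof (rule sum_mono, clarify)
      fix x y show "real (deg x + deg y) \<le> n + real (codeg x y)"
        using deg_pair_le[of x y] unfolding n_def by linarith
    qed
    also have "\<dots> = p * n + real (\<Sum>(x, y, z)\<in>triples ?M. codeg x y)"
      by (simp add: p_def case_prod_unfold sum.distrib)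
    also have "\<dots> \<le> p * n + real (card (heavy_pairs C) * (4 * card V))"
      using sum_codeg_heavy_le[OF free, of ?M C] by (simp only: add_le_cancel_left of_nat_le_iff mild_base_def)
    also have "real (card (heavy_pairs C) * (4 * card V)) = h * (4 * n)" by (simp add: h_def n_def)
    also have "\<dots> \<le> (100 * n) * (4 * n)" using hle n0 by (intro mult_right_mono) auto
    finally show ?thesis by (simp add: power2_eq_square)
  qed
  have light: "(\<Sum>v\<in>V. d v * l v) \<le> 14 / 75 * (q * n)"
  proof -
    have "6 * (\<Sum>v\<in>V. d v * l v) = (\<Sum>(x, y, z)\<in>triples (light C). real (deg x + deg y + deg z))"
      unfolding l_def d_def sum_deg_light by (simp add: sum_distrib_left)
    also have "\<dots> \<le> (\<Sum>(x, y, z)\<in>triples (light C). 28 / 25 * n)"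
    proof (rule sum_mono, clarify)
      fix x y z assume "(x, y, z) \<in> triples (light C)"
      then have c: "codeg x y \<le> C" "codeg x z \<le> C" "codeg y z \<le> C" by (auto simp: triples_def light_def)
      have "2 * (deg x + deg y + deg z) \<le> 2 * card V + 2 * (codeg x y + codeg x z + codeg y z)"
        using deg_triangle_le[of "{}" x y z] by simp
      then have "25 * (deg x + deg y + deg z) \<le> 28 * card V" using c C(1) by simp
      then have "real (25 * (deg x + deg y + deg z)) \<le> real (28 * card V)" by (simp only: of_nat_le_iff)
      then show "real (deg x + deg y + deg z) \<le> 28 / 25 * n" unfolding n_def by simp
    qed
    also have "\<dots> = q * (28 / 25 * n)" by (simp add: q_def case_prod_unfold)
    finally show ?thesis by (simp add: algebra_simps)
  qed
  have point: "n * (a v + 53 * l v / 75) - d v * (a v + l v) \<le> n\<^sup>2 / 4" if "v \<in> V" for v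
  proof (rule quadratic_bound_two)
    show "a v + l v / 2 \<le> d v"
      using link_count_mild[OF C1 free that, THEN of_nat_mono[where 'a = real]]
      by (simp add: a_def l_def d_def field_simps)
  qed (simp_all add: a_def l_def)
  have "(\<Sum>v\<in>V. n * (a v + 53 * l v / 75) - d v * (a v + l v)) \<le> (\<Sum>v\<in>V. n\<^sup>2 / 4)"
    by (rule sum_mono) (rule point)
  also have "\<dots> = n ^ 3 / 4" by (simp add: n_def power3_eq_cube power2_eq_square)
  also have "(\<Sum>v\<in>V. n * (a v + 53 * l v / 75) - d v * (a v + l v))
      = (\<Sum>v\<in>V. n * a v + 53 * n / 75 * l v - d v * a v - d v * l v)"
    by (intro sum.cong refl) (simp add: algebra_simps)
  also have "\<dots> = n * (\<Sum>v\<in>V. a v) + 53 * n / 75 * (\<Sum>v\<in>V. l v)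
      - (\<Sum>v\<in>V. d v * a v) - (\<Sum>v\<in>V. d v * l v)"
    by (simp only: sum_subtractf sum.distrib sum_distrib_left)
  finally have "n * p + 53 * n / 75 * (q / 2) - (\<Sum>v\<in>V. d v * a v) - (\<Sum>v\<in>V. d v * l v) \<le> n ^ 3 / 4"
    by (simp only: suma suml)
  \<comment> \<open>\<open>53 / 150 - 14 / 75 = 1 / 6\<close> remains as the coefficient of
    \<open>q\<close>, against \<open>1 / 2\<close> for \<open>p\<close>.\<close>
  then have "n * (q + 3 * p) \<le> 3 / 2 * n ^ 3 + 1200 * n\<^sup>2"
    using pair light by (simp add: algebra_simps)
  then have "n * (q + 3 * p) \<le> n * (3 / 2 * n\<^sup>2 + 1200 * n)"
    by (simp add: power2_eq_square power3_eq_cube algebra_simps)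
  then have qp: "q + 3 * p \<le> 3 / 2 * n\<^sup>2 + 1200 * n" using n0 by simp
  have "card (triples (heavy_base C)) \<le> card (triples ?M) + 208 * card (heavy_pairs C)"
    by (rule card_heavy_base_le_mild[OF free C(2)])
  then have "card (triples tri) \<le> card (triples (light C)) + 3 * (card (triples ?M) + 208 * card (heavy_pairs C))"
    using card_triples_le_light_heavy[of C] by simp
  then have "real (card (triples tri)) \<le> q + 3 * (p + 208 * h)"
    unfolding p_def q_def h_def by (simp flip: of_nat_le_iff[where 'a = real])
  then have "real (card (triples tri)) \<le> 3 / 2 * n\<^sup>2 + 63600 * n" using qp hle by simp
  then show ?thesis by (simp only: n_def)
qed

end

section \<open>Copies of the triangle and suspensions of paths\<close>

definition adj :: "'a ugraph \<Rightarrow> 'a \<Rightarrow> 'a \<Rightarrow> bool" where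
  "adj G u v \<longleftrightarrow> {u, v} \<in> edges G"

lemma fin_graph_adj:
  assumes "simple_graph G"
  shows "fin_graph (verts G) (adj G)"
proof
  show "finite (verts G)" using assms by (simp add: simple_graph_def)
  show "adj G x y \<Longrightarrow> adj G y x" for x y by (simp add: adj_def insert_commute)
  show "\<not> adj G x x" for x using assms by (force simp: adj_def simple_graph_def)
  show "adj G x y \<Longrightarrow> x \<in> verts G" for x y using assms by (auto simp: adj_def simple_graph_def)
qed

definition triangle_sets :: "'a ugraph \<Rightarrow> 'a set set" where
  "triangle_sets G = {X. X \<subseteq> verts G \<and> card X = 3 \<and> (\<forall>e. e \<subseteq> X \<and> card e = 2 \<longrightarrow> e \<in> edges G)}"

text \<open>All pairs in K_3 are edges, so a copy is determined by its vertex set.\<close>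

lemma copies_complete_graph_3:
  assumes G: "simple_graph G"
  shows "copies (complete_graph 3) G = (\<lambda>X. UGraph X {e. e \<subseteq> X \<and> card e = 2}) ` triangle_sets G"
proof (intro equalityI subsetI)
  fix S assume "S \<in> copies (complete_graph 3) G"
  then have S: "subgraph S G" and iso: "isomorphic (complete_graph 3) S" by (auto simp: copies_def)
  obtain f where f: "bij_betw f {..<3::nat} (verts S)"
    and e: "\<And>u v. u < 3 \<Longrightarrow> v < 3 \<Longrightarrow> {u, v} \<in> edges (complete_graph 3) \<longleftrightarrow> {f u, f v} \<in> edges S"
    using iso by (auto simp: isomorphic_def complete_graph_def)
  have "card (verts S) = 3" using bij_betw_same_card[OF f] by simp
  have edges: "edges S = {e. e \<subseteq> verts S \<and> card e = 2}"
  proof (intro equalityI subsetI)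
    fix d assume "d \<in> edges S"
    then show "d \<in> {e. e \<subseteq> verts S \<and> card e = 2}" using S by (auto simp: subgraph_def simple_graph_def)
  next
    fix d assume "d \<in> {e. e \<subseteq> verts S \<and> card e = 2}"
    then obtain a b where ab: "d = {a, b}" "a \<noteq> b" "a \<in> verts S" "b \<in> verts S" by (auto simp: card_2_iff)
    then obtain u v where uv: "u < 3" "v < 3" "f u = a" "f v = b"
      using f unfolding bij_betw_def by (metis imageE lessThan_iff)
    then have "{u, v} \<in> edges (complete_graph 3)" using ab(2) unfolding complete_graph_def by auto
    then have "{f u, f v} \<in> edges S" using e[OF uv(1,2)] by blast
    then show "d \<in> edges S" by (simp only: uv(3,4) ab(1))
  qed
  then have "verts S \<in> triangle_sets G"
    using S \<open>card (verts S) = 3\<close> by (auto simp: triangle_sets_def subgraph_def)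
  moreover have "S = UGraph (verts S) {e. e \<subseteq> verts S \<and> card e = 2}"
    using edges by (cases S) auto
  ultimately show "S \<in> (\<lambda>X. UGraph X {e. e \<subseteq> X \<and> card e = 2}) ` triangle_sets G" by (rule rev_image_eqI)
next
  fix S assume "S \<in> (\<lambda>X. UGraph X {e. e \<subseteq> X \<and> card e = 2}) ` triangle_sets G"
  then obtain X where X: "X \<in> triangle_sets G" and S: "S = UGraph X {e. e \<subseteq> X \<and> card e = 2}" by auto
  have fX: "finite X" "card X = 3" using X by (auto simp: triangle_sets_def intro: card_ge_0_finite)
  obtain f where f: "bij_betw f {0..<3::nat} X" using ex_bij_betw_nat_finite[OF fX(1)] fX(2) by auto
  have "subgraph S G"
    using X fX G S by (auto simp: subgraph_def simple_graph_def triangle_sets_def)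
  moreover have "isomorphic (complete_graph 3) S"
    unfolding isomorphic_def
  proof (intro exI[of _ f] conjI ballI)
    show "bij_betw f (verts (complete_graph 3)) (verts S)"
      using f by (simp add: complete_graph_def S lessThan_atLeast0)
    fix u v assume "u \<in> verts (complete_graph 3)" "v \<in> verts (complete_graph 3)"
    then have uv: "u < 3" "v < 3" by (auto simp: complete_graph_def)
    have inj: "f u = f v \<longleftrightarrow> u = v" "f u \<in> X" "f v \<in> X"
      using f uv by (auto simp: bij_betw_def inj_on_def)
    have "{u, v} \<in> edges (complete_graph 3) \<longleftrightarrow> u \<noteq> v"
      using uv by (auto simp: complete_graph_def doubleton_eq_iff)
    moreover have "{f u, f v} \<in> edges S \<longleftrightarrow> f u \<noteq> f v"
      using inj by (cases "f u = f v") (auto simp: S)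
    ultimately show "{u, v} \<in> edges (complete_graph 3) \<longleftrightarrow> {f u, f v} \<in> edges S" using inj by blast
  qed
  ultimately show "S \<in> copies (complete_graph 3) G" by (simp add: copies_def)
qed

lemma card_copies_complete_graph_3:
  assumes G: "simple_graph G"
  shows "6 * card (copies (complete_graph 3) G)
    = card {(x, y, z). adj G x y \<and> adj G x z \<and> adj G y z}"
proof -
  let ?T = "{(x, y, z). adj G x y \<and> adj G x z \<and> adj G y z}"
  let ?f = "\<lambda>(x, y, z). {x, y, z}"
  interpret fin_graph "verts G" "adj G" using G by (rule fin_graph_adj)
  have inV: "x \<in> verts G \<and> y \<in> verts G" "x \<noteq> y" if "adj G x y" for x y
    using that EV sym irr by blast+
  have finT: "finite ?T"
    by (rule finite_subset[of _ "verts G \<times> verts G \<times> verts G"]) (use inV finV in auto)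
  have finX: "finite (triangle_sets G)"
    by (rule finite_subset[of _ "Pow (verts G)"]) (use finV in \<open>auto simp: triangle_sets_def\<close>)
  have "?f ` ?T \<subseteq> triangle_sets G"
  proof clarify
    fix x y z assume a: "adj G x y" "adj G x z" "adj G y z"
    have "e \<in> edges G" if "e \<subseteq> {x, y, z}" "card e = 2" for e
    proof -
      obtain u v where "e = {u, v}" "u \<noteq> v" using \<open>card e = 2\<close> by (auto simp: card_2_iff)
      then show ?thesis using that a by (auto simp: adj_def insert_commute)
    qed
    moreover have "card {x, y, z} = 3" using inV(2)[OF a(1)] inV(2)[OF a(2)] inV(2)[OF a(3)] by simp
    ultimately show "{x, y, z} \<in> triangle_sets G"
      using inV(1)[OF a(1)] inV(1)[OF a(3)] by (auto simp: triangle_sets_def)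
  qed
  then have "(\<Sum>X\<in>triangle_sets G. \<Sum>t\<in>{t \<in> ?T. ?f t = X}. 1) = (\<Sum>t\<in>?T. 1 :: nat)"
    by (rule sum.group[OF finT finX])
  moreover have "card {t \<in> ?T. ?f t = X} = 6" if X: "X \<in> triangle_sets G" for X
  proof -
    have fX: "finite X" "card X = 3" using X by (auto simp: triangle_sets_def intro: card_ge_0_finite)
    have full: "{x, y, z} = X" if "x \<in> X" "y \<in> X" "z \<in> X" "x \<noteq> y" "x \<noteq> z" "y \<noteq> z" for x y z
      using that fX by (intro card_subset_eq) auto
    have ad: "adj G x y" if "x \<in> X" "y \<in> X" "x \<noteq> y" for x y
      using X that by (auto simp: triangle_sets_def adj_def)
    have "{t \<in> ?T. ?f t = X} = Sigma X (\<lambda>x. Sigma (X - {x}) (\<lambda>y. X - {x, y}))"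
    proof (intro equalityI subsetI)
      fix t assume t: "t \<in> {t \<in> ?T. ?f t = X}"
      obtain x y z where xyz: "t = (x, y, z)" by (cases t)
      then have "X = {x, y, z}" "x \<noteq> y" "x \<noteq> z" "y \<noteq> z" using t inV(2) by auto
      then show "t \<in> Sigma X (\<lambda>x. Sigma (X - {x}) (\<lambda>y. X - {x, y}))" unfolding xyz by auto
    next
      fix t assume t: "t \<in> Sigma X (\<lambda>x. Sigma (X - {x}) (\<lambda>y. X - {x, y}))"
      obtain x y z where xyz: "t = (x, y, z)" by (cases t)
      then have m: "x \<in> X" "y \<in> X" "z \<in> X" "x \<noteq> y" "x \<noteq> z" "y \<noteq> z" using t by auto
      then show "t \<in> {t \<in> ?T. ?f t = X}"
        using ad[OF m(1,2,4)] ad[OF m(1,3,5)] ad[OF m(2,3,6)] full[OF m] by (simp add: xyz)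
    qed
    also have "card \<dots> = (\<Sum>x\<in>X. \<Sum>y\<in>X - {x}. card (X - {x, y}))"
      using fX by (simp add: card_SigmaI)
    also have "\<dots> = (\<Sum>x\<in>X. \<Sum>y\<in>X - {x}. 1)"
      using fX by (intro sum.cong refl) (auto simp: card_Diff_subset card_insert_if)
    also have "\<dots> = 6" using fX by simp
    finally show ?thesis .
  qed
  ultimately have "6 * card (triangle_sets G) = card ?T" by simp
  moreover have "inj_on (\<lambda>X. UGraph X {e. e \<subseteq> X \<and> card e = 2}) (triangle_sets G)"
    by (simp add: inj_on_def)
  ultimately show ?thesis
    by (simp add: copies_complete_graph_3[OF G] card_image)
qed

section \<open>Suspensions of paths and paths in links\<close>

lemma not_free_of_if_embedding:
  assumes H: "simple_graph H" and G: "simple_graph G" and f: "inj_on f (verts H)" "f ` verts H \<subseteq> verts G"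
    and e: "\<And>e. e \<in> edges H \<Longrightarrow> f ` e \<in> edges G"
  shows "\<not> free_of H G"
proof -
  define S where "S = UGraph (f ` verts H) ((`) f ` edges H)"
  have eH: "e \<subseteq> verts H" "card e = 2" if "e \<in> edges H" for e
    using H that by (auto simp: simple_graph_def)
  have "card (f ` e) = 2" if "e \<in> edges H" for e
    using eH[OF that] f(1) by (metis card_image inj_on_subset)
  then have "simple_graph S"
    using H eH(1) by (auto simp: S_def simple_graph_def)
  then have "subgraph S G" using G f e by (auto simp: subgraph_def S_def)
  moreover have "isomorphic H S"
    unfolding isomorphic_def
  proof (intro exI[of _ f] conjI ballI)
    show "bij_betw f (verts H) (verts S)" using f by (simp add: S_def bij_betw_def)
    fix u v assume "u \<in> verts H" "v \<in> verts H"
    then have "f ` {u, v} \<in> (`) f ` edges H \<longleftrightarrow> {u, v} \<in> edges H"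
      using inj_on_image_eq_iff[OF f(1)] eH(1) by (auto simp del: image_insert image_empty)
    then show "{u, v} \<in> edges H \<longleftrightarrow> {f u, f v} \<in> edges S" by (simp add: S_def)
  qed
  ultimately show ?thesis by (auto simp: free_of_def)
qed

text \<open>Adjacency to every \<open>p i\<close> already makes \<open>x\<close> different from
  them, so injectivity is only asked of the path.\<close>

lemma free_of_suspension_path_graph:
  assumes G: "simple_graph G"
  shows "free_of (suspension (path_graph k)) G \<longleftrightarrow>
    \<not> (\<exists>x p. inj_on p {..k} \<and> (\<forall>i\<le>k. adj G x (p i)) \<and> (\<forall>i<k. adj G (p i) (p (Suc i))))"
proof -
  let ?H = "suspension (path_graph k)"
  interpret fin_graph "verts G" "adj G" using G by (rule fin_graph_adj)
  have vH: "verts ?H = insert None (Some ` {..k})"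
    by (simp add: suspension_def path_graph_def)
  have eH: "edges ?H = {{Some i, Some (Suc i)} | i. i < k} \<union> {{None, Some i} | i. i \<le> k}"
    by (auto simp: suspension_def path_graph_def image_iff) blast
  have "\<not> free_of ?H G" if p: "inj_on p {..k}" "\<forall>i\<le>k. adj G x (p i)" "\<forall>i<k. adj G (p i) (p (Suc i))" for x p
  proof (rule not_free_of_if_embedding[OF _ G])
    let ?f = "case_option x p"
    show "simple_graph ?H" by (simp add: simple_graph_suspension simple_graph_path_graph)
    show "inj_on ?f (verts ?H)" using p irr by (fastforce simp: vH inj_on_def)
    have "x \<in> verts G" using p(2) EV by blast
    moreover have "p i \<in> verts G" if "i \<le> k" for i using p(2) that EV sym by blast
    ultimately show "?f ` verts ?H \<subseteq> verts G" by (auto simp: vH)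
    show "?f ` e \<in> edges G" if "e \<in> edges ?H" for e
      using that p by (auto simp: eH adj_def)
  qed
  moreover have "\<exists>x p. inj_on p {..k} \<and> (\<forall>i\<le>k. adj G x (p i)) \<and> (\<forall>i<k. adj G (p i) (p (Suc i)))"
    if "\<not> free_of ?H G"
  proof -
    obtain S f where S: "subgraph S G" and f: "bij_betw f (verts ?H) (verts S)"
      and e: "\<And>u v. u \<in> verts ?H \<Longrightarrow> v \<in> verts ?H \<Longrightarrow> {u, v} \<in> edges ?H \<longleftrightarrow> {f u, f v} \<in> edges S"
      using \<open>\<not> free_of ?H G\<close> unfolding free_of_def isomorphic_def by blast
    have eS: "adj G (f u) (f v)" if "u \<in> verts ?H" "v \<in> verts ?H" "{u, v} \<in> edges ?H" for u v
      using e[OF that(1,2)] that(3) S by (auto simp: adj_def subgraph_def)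
    have "inj_on (\<lambda>i. f (Some i)) {..k}"
      using f by (auto simp: bij_betw_def vH inj_on_def)
    moreover have "\<forall>i\<le>k. adj G (f None) (f (Some i))"
      by (auto intro!: eS simp: vH eH)
    moreover have "\<forall>i<k. adj G (f (Some i)) (f (Some (Suc i)))"
      by (auto intro!: eS simp: vH eH)
    ultimately show ?thesis by blast
  qed
  ultimately show ?thesis by blast
qed

lemma free_of_suspension_path_graph_mono:
  assumes "simple_graph G" "free_of (suspension (path_graph j)) G" "j \<le> k"
  shows "free_of (suspension (path_graph k)) G"
  using assms(2,3) unfolding free_of_suspension_path_graph[OF assms(1)]
  by (meson atMost_subset_iff inj_on_subset le_trans less_le_trans)

text \<open>The first \<open>k + 1\<close> entries of a longer list form a path with
  \<open>k\<close> edges, and \<open>x\<close> takes the role of the added vertex.\<close>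

lemma path_free_link:
  assumes G: "simple_graph G" and free: "free_of (suspension (path_graph k)) G"
  shows "path_free (adj G) (nb (adj G) (verts G) x) (Suc k)"
  unfolding path_free_def
proof (intro allI impI)
  fix xs assume xs: "path_in (adj G) (nb (adj G) (verts G) x) xs"
  show "length xs < Suc k"
  proof (rule ccontr)
    assume "\<not> length xs < Suc k"
    then have len: "k < length xs" by simp
    have "inj_on ((!) xs) {..k}"
      using xs len by (auto simp: path_in_def inj_on_def nth_eq_iff_index_eq)
    moreover have "adj G x (xs ! i)" if "i \<le> k" for i
    proof -
      have "xs ! i \<in> set xs" using that len by simp
      then show ?thesis using xs by (auto simp: path_in_def nb_def)
    qed
    moreover have "adj G (xs ! i) (xs ! Suc i)" if "i < k" for i
      using xs that len by (auto simp: path_in_def successively_conv_nth)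
    ultimately show False using free unfolding free_of_suspension_path_graph[OF G] by blast
  qed
qed

section \<open>From ordered triangles to generalized Turan numbers\<close>

lemma gen_turan_le:
  fixes B :: real
  assumes "simple_graph H" "edges H \<noteq> {}"
    and "\<And>G :: nat ugraph. simple_graph G \<Longrightarrow> card (verts G) = n \<Longrightarrow> free_of H G \<Longrightarrow> real (card (copies T G)) \<le> B"
  shows "real (gen_turan n T H) \<le> B"
proof -
  have "gen_turan n T H \<in> copy_counts n T H"
    unfolding gen_turan_def
    by (rule Max_in) (simp_all add: finite_copy_counts copy_counts_nonempty[OF assms(1,2)])
  then show ?thesis using assms(3) by (auto simp: copy_counts_def)
qed

lemma card_copies_le_gen_turan:
  fixes G :: "nat ugraph"
  assumes "simple_graph G" "free_of H G"
  shows "card (copies T G) \<le> gen_turan (card (verts G)) T H"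
  unfolding gen_turan_def
  by (rule Max_ge[OF finite_copy_counts]) (use assms in \<open>auto simp: copy_counts_def\<close>)

lemma suspension_path_graph_simple:
  "simple_graph (suspension (path_graph k))" "edges (suspension (path_graph k)) \<noteq> {}"
  by (simp_all add: simple_graph_suspension simple_graph_path_graph) (auto simp: suspension_def path_graph_def)

lemma gen_turan_le_if_triples:
  fixes B :: real
  assumes "\<And>(V :: nat set) E. fin_graph V E \<Longrightarrow> card V = n \<Longrightarrow> (\<And>x. path_free E (nb E V x) (Suc k)) \<Longrightarrow>
    real (card {(x, y, z). E x y \<and> E x z \<and> E y z}) \<le> 6 * B"
  shows "real (gen_turan n (complete_graph 3) (suspension (path_graph k))) \<le> B"
proof (rule gen_turan_le[OF suspension_path_graph_simple])
  fix G :: "nat ugraph"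
  assume G: "simple_graph G" "card (verts G) = n" "free_of (suspension (path_graph k)) G"
  have "real (6 * card (copies (complete_graph 3) G)) \<le> 6 * B"
    unfolding card_copies_complete_graph_3[OF G(1)]
    by (rule assms[OF fin_graph_adj[OF G(1)] G(2) path_free_link[OF G(1,3)]])
  then show "real (card (copies (complete_graph 3) G)) \<le> B" by simp
qed

section \<open>Lower bound and asymptotics\<close>

text \<open>The first $(q+1)m$ vertices are split into $m$ cliques on $q+1$ vertices and joined to all others.\<close>

definition clique_join_adj :: "nat \<Rightarrow> nat \<Rightarrow> nat \<Rightarrow> nat \<Rightarrow> nat \<Rightarrow> bool" where
  "clique_join_adj q m n u v \<longleftrightarrow> u < n \<and> v < n \<and>
    ((u < Suc q * m \<and> v < Suc q * m \<and> u \<noteq> v \<and> u div Suc q = v div Suc q)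
      \<or> (u < Suc q * m \<and> Suc q * m \<le> v) \<or> (v < Suc q * m \<and> Suc q * m \<le> u))"

definition clique_join :: "nat \<Rightarrow> nat \<Rightarrow> nat \<Rightarrow> nat ugraph" where
  "clique_join q m n = UGraph {..<n} {{u, v} | u v. clique_join_adj q m n u v}"

lemma adj_clique_join: "adj (clique_join q m n) u v \<longleftrightarrow> clique_join_adj q m n u v"
proof -
  have "clique_join_adj q m n b a" if "clique_join_adj q m n a b" for a b
    using that by (auto simp: clique_join_adj_def)
  then show ?thesis by (auto simp: adj_def clique_join_def doubleton_eq_iff)
qed

lemma simple_graph_clique_join: "simple_graph (clique_join q m n)"
proof -
  have "u \<noteq> v \<and> u < n \<and> v < n" if "clique_join_adj q m n u v" for u v
    using that by (auto simp: clique_join_adj_def)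
  then show ?thesis by (fastforce simp: simple_graph_def clique_join_def)
qed

lemma block_eq: "{u :: nat. u div Suc q = c} = {c * Suc q..<c * Suc q + Suc q}"
proof -
  have 1: "u div Suc q = c \<longleftrightarrow> c \<le> u div Suc q \<and> u div Suc q < Suc c" for u by auto
  have 2: "c \<le> u div Suc q \<longleftrightarrow> c * Suc q \<le> u" "u div Suc q < Suc c \<longleftrightarrow> u < Suc c * Suc q" for u
    by (rule less_eq_div_iff_mult_less_eq, simp, rule div_less_iff_less_mult, simp)
  have 3: "Suc c * Suc q = c * Suc q + Suc q" by simp
  have "u div Suc q = c \<longleftrightarrow> c * Suc q \<le> u \<and> u < c * Suc q + Suc q" for u
    unfolding 1 2 3 by (rule refl)
  then show ?thesis by (intro set_eqI) (simp only: mem_Collect_eq atLeastLessThan_iff)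
qed

text \<open>A vertex of the independent side sees only cliques on \<open>q + 1\<close> vertices. A
  vertex of a clique sees its \<open>q\<close> mates and an independent set, and a path on
  \<open>2 * q + 2\<close> vertices needs at least \<open>q + 1\<close> vertices outside an
  independent set.\<close>

lemma free_of_clique_join: "free_of (suspension (path_graph (2 * q + 1))) (clique_join q m n)"
  unfolding free_of_suspension_path_graph[OF simple_graph_clique_join] adj_clique_join
proof
  let ?k = "2 * q + 1" and ?s = "Suc q * m" and ?R = "clique_join_adj q m n"
  assume "\<exists>x p. inj_on p {..?k} \<and> (\<forall>i\<le>?k. ?R x (p i)) \<and> (\<forall>i<?k. ?R (p i) (p (Suc i)))"
  then obtain x p where p: "inj_on p {..?k}" and xp: "\<And>i. i \<le> ?k \<Longrightarrow> ?R x (p i)"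
    and pp: "\<And>i. i < ?k \<Longrightarrow> ?R (p i) (p (Suc i))" by blast
  have cb: "card {u. u div Suc q = c} = Suc q" "finite {u. u div Suc q = c}" for c
    by (simp_all only: block_eq card_atLeastLessThan finite_atLeastLessThan)
  show False
  proof (cases "x < ?s")
    case False
    have small: "p i < ?s" if "i \<le> ?k" for i
      using xp[OF that] False by (auto simp: clique_join_adj_def)
    have same: "p i div Suc q = p 0 div Suc q" if "i \<le> ?k" for i
      using that
    proof (induction i)
      case (Suc i)
      then have "p i div Suc q = p (Suc i) div Suc q"
        using pp[of i] small[of i] small[of "Suc i"] by (auto simp: clique_join_adj_def)
      then show ?case using Suc by simp
    qed simp
    have "p ` {..?k} \<subseteq> {u. u div Suc q = p 0 div Suc q}"
      by (intro image_subsetI CollectI same) simp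
    then have "card (p ` {..?k}) \<le> card {u. u div Suc q = p 0 div Suc q}" by (rule card_mono[OF cb(2)])
    then have "card (p ` {..?k}) \<le> Suc q" by (simp only: cb(1))
    then show False using card_image[OF p] by simp
  next
    case True
    define I where "I = {i. i \<le> ?k \<and> p i < ?s}"
    have finI: "finite I" by (auto simp: I_def)
    have "p ` I \<subseteq> {u. u div Suc q = x div Suc q} - {x}"
    proof (rule image_subsetI)
      fix i assume "i \<in> I"
      then have "?R x (p i)" "p i < ?s" using xp by (auto simp: I_def)
      then show "p i \<in> {u. u div Suc q = x div Suc q} - {x}"
        using True by (auto simp: clique_join_adj_def)
    qed
    then have "card (p ` I) \<le> card ({u. u div Suc q = x div Suc q} - {x})"
      by (rule card_mono[rotated]) (simp add: cb)
    also have "\<dots> = q" using cb by (subst card_Diff_singleton) auto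
    finally have "card (p ` I) \<le> q" .
    moreover have "I \<subseteq> {..?k}" by (auto simp: I_def)
    ultimately have "card I \<le> q" using card_image[OF inj_on_subset[OF p]] by metis
    \<comment> \<open>Each of the \<open>q + 1\<close> disjoint pairs of positions
      \<open>2 * j\<close> and \<open>2 * j + 1\<close> spans an edge, so one of its ends lies in a
      clique.\<close>
    have "{..q} \<subseteq> (\<lambda>i. i div 2) ` I"
    proof
      fix j assume "j \<in> {..q}"
      then have j: "2 * j < ?k" by simp
      have "2 * j \<in> I \<or> Suc (2 * j) \<in> I"
        using pp[OF j] j by (auto simp: I_def clique_join_adj_def)
      then show "j \<in> (\<lambda>i. i div 2) ` I"
      proof
        assume "2 * j \<in> I"
        then show ?thesis by (intro rev_image_eqI[of "2 * j"]) auto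
      next
        assume "Suc (2 * j) \<in> I"
        then show ?thesis by (intro rev_image_eqI[of "Suc (2 * j)"]) auto
      qed
    qed
    then have "card {..q} \<le> card I" using finI by (rule surj_card_le[rotated])
    then show False using \<open>card I \<le> q\<close> by simp
  qed
qed

text \<open>Only triangles with two vertices in a clique and one outside are counted.
  \<open>D\<close> lists them with the outside vertex last; \<open>?g\<close> and \<open>?h\<close>
  move it to the middle and to the front.\<close>

lemma card_triangles_clique_join:
  assumes "Suc q * m \<le> n"
  shows "3 * (Suc q * m * (q * (n - Suc q * m))) \<le> card {(x, y, z). adj (clique_join q m n) x y
    \<and> adj (clique_join q m n) x z \<and> adj (clique_join q m n) y z}"
proof -
  let ?s = "Suc q * m" and ?R = "clique_join_adj q m n"
  let ?T = "{(x, y, z). ?R x y \<and> ?R x z \<and> ?R y z}"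
  define bl where "bl a = {u. u div Suc q = a div Suc q} - {a}" for a
  define D where "D = Sigma {..<?s} (\<lambda>a. bl a \<times> {?s..<n})"
  have cb: "card {u. u div Suc q = c} = Suc q" "finite {u. u div Suc q = c}" for c
    by (simp_all only: block_eq card_atLeastLessThan finite_atLeastLessThan)
  have bl: "card (bl a) = q" "finite (bl a)" for a
    unfolding bl_def using cb by (simp_all add: card_Diff_singleton)
  have bls: "u < ?s" if "a < ?s" "u \<in> bl a" for a u
  proof -
    have "a div Suc q < m" using that(1) by (metis less_mult_imp_div_less mult.commute)
    then have "u div Suc q < m" using that(2) by (simp add: bl_def)
    then show ?thesis by (metis div_less_iff_less_mult mult.commute zero_less_Suc)
  qed
  have "card D = (\<Sum>a<?s. card (bl a \<times> {?s..<n}))" unfolding D_def using bl by (subst card_SigmaI) auto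
  then have cD: "card D = ?s * (q * (n - ?s))" by (simp add: bl card_cartesian_product)
  have fD: "finite D" unfolding D_def using bl by (intro finite_SigmaI) auto
  have D: "a < ?s \<and> b < ?s \<and> ?s \<le> c \<and> ?R a b \<and> ?R b a \<and> ?R a c \<and> ?R c a \<and> ?R b c \<and> ?R c b"
    if "(a, b, c) \<in> D" for a b c
    using that assms bls[of a b] by (auto simp: D_def bl_def clique_join_adj_def)
  let ?g = "\<lambda>(a, b, c). (a, c, b)" and ?h = "\<lambda>(a, b, c). (c, a, b)"
  have "card (D \<union> ?g ` D \<union> ?h ` D) = card D + card (?g ` D) + card (?h ` D)"
  proof -
    have "?s \<le> snd (snd t)" "fst (snd t) < ?s" "fst t < ?s" if "t \<in> D" for t
      using D[of "fst t" "fst (snd t)" "snd (snd t)"] that by auto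
    moreover have "?s \<le> fst (snd t)" "fst t < ?s" if "t \<in> ?g ` D" for t
      using D that by auto
    moreover have "?s \<le> fst t" if "t \<in> ?h ` D" for t
      using D that by auto
    ultimately have "D \<inter> ?g ` D = {}" "(D \<union> ?g ` D) \<inter> ?h ` D = {}"
      by (meson UnE disjoint_iff not_le)+
    then show ?thesis using fD by (simp add: card_Un_disjoint)
  qed
  also have "\<dots> = 3 * card D" by (simp add: card_image inj_on_def split_def prod_eq_iff)
  finally have "3 * card D = card (D \<union> ?g ` D \<union> ?h ` D)" by simp
  also have "\<dots> \<le> card ?T"
  proof (rule card_mono)
    show "finite ?T"
      by (rule finite_subset[of _ "{..<n} \<times> {..<n} \<times> {..<n}"]) (auto simp: clique_join_adj_def)
    show "D \<union> ?g ` D \<union> ?h ` D \<subseteq> ?T" using D by auto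
  qed
  finally show ?thesis by (simp only: cD adj_clique_join)
qed

text \<open>The clique side has \<open>s\<close> vertices, as close to n/2 as multiples of
  \<open>Suc q\<close> below n/2 allow, which nearly maximizes \<open>s * (n - s)\<close>. By
  monotonicity in \<open>k\<close>, \<open>q = 1\<close> serves both k = 3 and k = 4.\<close>

lemma gen_turan_ge:
  assumes "2 * q + 1 \<le> k"
  shows "real q * (real n)\<^sup>2 / 8 - real (q * Suc q) * real n / 4
    \<le> real (gen_turan n (complete_graph 3) (suspension (path_graph k)))"
proof -
  define m where "m = n div (2 * Suc q)"
  define s where "s = Suc q * m"
  let ?G = "clique_join q m n"
  have mn: "2 * Suc q * m \<le> n" unfolding m_def by (rule times_div_less_eq_dividend)
  have mn': "n < 2 * Suc q * m + 2 * Suc q"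
    unfolding m_def by (subst add.commute, rule dividend_less_times_div) simp
  from mn mn' have s: "2 * s \<le> n" "n < 2 * s + 2 * Suc q" unfolding s_def by (simp_all only: mult.assoc)
  have "3 * (s * (q * (n - s))) \<le> 6 * card (copies (complete_graph 3) ?G)"
    unfolding card_copies_complete_graph_3[OF simple_graph_clique_join] s_def
    by (rule card_triangles_clique_join) (use s in \<open>simp add: s_def\<close>)
  also have "card (copies (complete_graph 3) ?G) \<le> gen_turan n (complete_graph 3) (suspension (path_graph k))"
    using card_copies_le_gen_turan[OF simple_graph_clique_join
        free_of_suspension_path_graph_mono[OF simple_graph_clique_join free_of_clique_join assms]]
    by (simp add: clique_join_def)
  finally have "s * (q * (n - s)) \<le> 2 * gen_turan n (complete_graph 3) (suspension (path_graph k))"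
    by (simp add: ac_simps)
  then have upper: "real (s * (q * (n - s))) \<le> 2 * real (gen_turan n (complete_graph 3) (suspension (path_graph k)))"
    by (metis of_nat_le_iff of_nat_mult of_nat_numeral)
  have "real q * (real n / 2 - real (Suc q)) * (real n / 2) \<le> real (s * (q * (n - s)))"
  proof -
    have "real n < real (2 * s + 2 * Suc q)" using s(2) by (simp only: of_nat_less_iff)
    then have 1: "real n / 2 - real (Suc q) \<le> real s" by simp
    have "real (2 * s) \<le> real n" "s \<le> n" using s(1) by (simp_all only: of_nat_le_iff)
    then have 2: "real n / 2 \<le> real (n - s)" by (simp add: of_nat_diff)
    have "(real n / 2 - real (Suc q)) * (real n / 2) \<le> real s * (real n / 2)"
      using 1 by (rule mult_right_mono) simp
    also have "\<dots> \<le> real s * real (n - s)" using 2 by (rule mult_left_mono) simp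
    finally have "real q * ((real n / 2 - real (Suc q)) * (real n / 2)) \<le> real q * (real s * real (n - s))"
      by (rule mult_left_mono) simp
    then show ?thesis by (simp only: of_nat_mult ac_simps)
  qed
  from order_trans[OF this upper] have "real q * (real n / 2 - real (Suc q)) * (real n / 2)
      \<le> 2 * real (gen_turan n (complete_graph 3) (suspension (path_graph k)))" .
  also have "real q * (real n / 2 - real (Suc q)) * (real n / 2)
      = 2 * (real q * (real n)\<^sup>2 / 8 - real (q * Suc q) * real n / 4)"
    by (simp only: of_nat_mult power2_eq_square) (simp add: algebra_simps)
  finally have "2 * (real q * (real n)\<^sup>2 / 8 - real (q * Suc q) * real n / 4)
      \<le> 2 * real (gen_turan n (complete_graph 3) (suspension (path_graph k)))" .
  then show ?thesis by (rule mult_left_le_imp_le) simp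
qed

section \<open>The error terms for k = 3, 4, 5\<close>

lemma gen_turan_path_3_le:
  "real (gen_turan n (complete_graph 3) (suspension (path_graph 3))) \<le> (real n)\<^sup>2 / 8 + 21 / 2 * real n"
proof (rule gen_turan_le_if_triples)
  fix V :: "nat set" and E
  assume G: "fin_graph V E" "card V = n" "\<And>x. path_free E (nb E V x) (Suc 3)"
  interpret fin_graph V E by (rule G)
  have "real (card (triples tri)) \<le> 3 / 4 * (real n)\<^sup>2 + 63 * real n"
    using card_triples_le_if_link_path_free_4 G by simp
  then show "real (card {(x, y, z). E x y \<and> E x z \<and> E y z}) \<le> 6 * ((real n)\<^sup>2 / 8 + 21 / 2 * real n)"
    by (simp add: triples_def tri_def)
qed

lemma gen_turan_path_4_le:
  assumes "4 \<le> C"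
  shows "real (gen_turan n (complete_graph 3) (suspension (path_graph 4)))
    \<le> (real n)\<^sup>2 / 8 + (3 / 2 + 3 * real C) * real n + 6 * (real n)\<^sup>2 / real C"
proof (rule gen_turan_le_if_triples)
  fix V :: "nat set" and E
  assume G: "fin_graph V E" "card V = n" "\<And>x. path_free E (nb E V x) (Suc 4)"
  interpret fin_graph V E by (rule G)
  have "real (card (triples tri)) \<le> 3 / 4 * (real n)\<^sup>2 + (9 + 18 * real C) * real n + 36 * (real n)\<^sup>2 / real C"
    using card_triples_le_if_link_path_free_5[of C] G assms by simp
  then show "real (card {(x, y, z). E x y \<and> E x z \<and> E y z})
    \<le> 6 * ((real n)\<^sup>2 / 8 + (3 / 2 + 3 * real C) * real n + 6 * (real n)\<^sup>2 / real C)"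
    by (simp add: triples_def tri_def algebra_simps)
qed

lemma gen_turan_path_5_le:
  "real (gen_turan n (complete_graph 3) (suspension (path_graph 5))) \<le> (real n)\<^sup>2 / 4 + 10600 * real n"
proof (rule gen_turan_le_if_triples)
  fix V :: "nat set" and E
  assume G: "fin_graph V E" "card V = n" "\<And>x. path_free E (nb E V x) (Suc 5)"
  interpret fin_graph V E by (rule G)
  have "real (card (triples tri)) \<le> 3 / 2 * (real n)\<^sup>2 + 63600 * real n"
    using card_triples_le_if_link_path_free_6 G by simp
  then show "real (card {(x, y, z). E x y \<and> E x z \<and> E y z}) \<le> 6 * ((real n)\<^sup>2 / 4 + 10600 * real n)"
    by (simp add: triples_def tri_def)
qed

lemma linear_in_smallo_square: "(\<lambda>n. real n) \<in> o(\<lambda>n. (real n)\<^sup>2)"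
proof (rule landau_o.smallI)
  fix c :: real assume "c > 0"
  show "\<forall>\<^sub>F n in sequentially. norm (real n) \<le> c * norm ((real n)\<^sup>2)"
  proof (rule eventually_sequentiallyI)
    fix n assume "nat \<lceil>1 / c\<rceil> \<le> n"
    then have "1 / c \<le> real n" by linarith
    then have "1 \<le> c * real n" using \<open>c > 0\<close> by (simp add: field_simps)
    then have "1 * real n \<le> c * real n * real n" by (intro mult_right_mono) auto
    then show "norm (real n) \<le> c * norm ((real n)\<^sup>2)" by (simp add: power2_eq_square mult.assoc)
  qed
qed

lemma gen_turan_path_3_error:
  "(\<lambda>n. real (gen_turan n (complete_graph 3) (suspension (path_graph 3))) - (real n)\<^sup>2 / 8) \<in> O(\<lambda>n. real n)"
proof (rule bigoI[of _ 11], rule always_eventually, rule allI)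
  fix n
  show "norm (real (gen_turan n (complete_graph 3) (suspension (path_graph 3))) - (real n)\<^sup>2 / 8) \<le> 11 * norm (real n)"
    using gen_turan_path_3_le[of n] gen_turan_ge[of 1 3 n] by (simp add: abs_le_iff)
qed

lemma gen_turan_path_5_error:
  "(\<lambda>n. real (gen_turan n (complete_graph 3) (suspension (path_graph 5))) - (real n)\<^sup>2 / 4) \<in> O(\<lambda>n. real n)"
proof (rule bigoI[of _ 10600], rule always_eventually, rule allI)
  fix n
  show "norm (real (gen_turan n (complete_graph 3) (suspension (path_graph 5))) - (real n)\<^sup>2 / 4) \<le> 10600 * norm (real n)"
    using gen_turan_path_5_le[of n] gen_turan_ge[of 2 5 n] by (simp add: abs_le_iff)
qed

lemma gen_turan_path_4_error:
  "(\<lambda>n. real (gen_turan n (complete_graph 3) (suspension (path_graph 4))) - (real n)\<^sup>2 / 8) \<in> o(\<lambda>n. (real n)\<^sup>2)"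
proof (rule landau_o.smallI)
  fix c :: real assume c: "c > 0"
  \<comment> \<open>\<open>12 / c\<close> keeps the quadratic error within half of the allowance
    \<open>c\<close>; the other half covers the linear term once \<open>n\<close> reaches
    \<open>2 * b / c\<close>.\<close>
  define C where "C = nat \<lceil>12 / c\<rceil> + 4"
  have C: "4 \<le> C" "12 / c \<le> real C" unfolding C_def by (simp, linarith)
  then have C': "6 / real C \<le> c / 2" using c by (simp add: field_simps)
  define b where "b = 3 / 2 + 3 * real C"
  show "\<forall>\<^sub>F n in sequentially. norm (real (gen_turan n (complete_graph 3) (suspension (path_graph 4))) - (real n)\<^sup>2 / 8)
    \<le> c * norm ((real n)\<^sup>2)"
  proof (rule eventually_sequentiallyI)
    fix n assume "nat \<lceil>2 * b / c\<rceil> \<le> n"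
    then have "2 * b / c \<le> real n" by linarith
    then have "b \<le> c / 2 * real n" using c by (simp add: field_simps)
    then have "b * real n \<le> c / 2 * real n * real n" by (rule mult_right_mono) simp
    then have 1: "b * real n \<le> c / 2 * (real n)\<^sup>2" by (simp add: power2_eq_square)
    have "6 / real C * (real n)\<^sup>2 \<le> c / 2 * (real n)\<^sup>2" using C' by (rule mult_right_mono) simp
    then have 2: "6 * (real n)\<^sup>2 / real C \<le> c / 2 * (real n)\<^sup>2" by simp
    have "real n / 2 \<le> b * real n" unfolding b_def by (simp add: algebra_simps)
    moreover have "0 \<le> c / 2 * (real n)\<^sup>2" using c by simp
    ultimately show "norm (real (gen_turan n (complete_graph 3) (suspension (path_graph 4))) - (real n)\<^sup>2 / 8)
      \<le> c * norm ((real n)\<^sup>2)"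
      using 1 2 gen_turan_path_4_le[OF C(1), of n] gen_turan_ge[of 1 4 n]
      by (simp add: abs_le_iff flip: b_def)
  qed
qed

theorem theorem1p4:
  shows "(\<forall>k\<in>{3, 4, 5::nat}.
           (\<lambda>n::nat. real (gen_turan n (complete_graph 3) (suspension (path_graph k)))
              - of_int \<lfloor>(real k - 1) / 2\<rfloor> * ((real n)^2 / 8)) \<in> o(\<lambda>n. (real n)^2)) \<and>
         (\<forall>k\<in>{3, 5::nat}.
           (\<lambda>n::nat. real (gen_turan n (complete_graph 3) (suspension (path_graph k)))
              - of_int \<lfloor>(real k - 1) / 2\<rfloor> * ((real n)^2 / 8)) \<in> O(\<lambda>n. real n))"
proof -
  have fl: "\<lfloor>(real 3 - 1) / 2\<rfloor> = 1" "\<lfloor>(real 4 - 1) / 2\<rfloor> = 1" "\<lfloor>(real 5 - 1) / 2\<rfloor> = 2"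
    by (simp_all add: floor_eq_iff)
  show ?thesis
    using gen_turan_path_3_error gen_turan_path_4_error gen_turan_path_5_error
      landau_o.big_small_trans[OF _ linear_in_smallo_square]
    by (simp add: fl)
qed

end
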